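(* Let $d\ge 2$ be an integer and let $X$ be a $BB$ space on $\mathbb{T}^{d}$ such that $(L^{\infty},X)$ is an interpolation couple, $L^{\infty}\cap X$ has a separable predual, and $X\hookrightarrow H^{-m}$ for some $m>d/2$. Then, for any $\theta\in(0,1)$ and $q\in[1,\infty)$, the real interpolation space $X_{\theta,q}:=(L^{\infty},X)_{\theta,q}$ is a $BB$ space.
   Context: All function spaces are on the torus $\mathbb{T}^{d}$, $d\ge 2$. For a function space $X$ on $\mathbb{T}^d$ and a vector field $u=(u_1,\dots,u_d)$ on $\mathbb{T}^d$, one writes $u\in X$ if every component $u_j$ belongs to $X$ (that is, $u\in X^d$). A Banach function space $X$ on $\mathbb{T}^{d}$ is called a Bourgain-Brezis space ($BB$ space) if for any vector field $v\in X$ there exists a vector field $u\in L^{\infty}\cap X$ such that $\operatorname{div}u=\operatorname{div}v$ in the sense of distributions on $\mathbb{T}^{d}$. $H^{s}=W^{s,2}$ denotes the usual $L^2$-based Sobolev space on $\mathbb{T}^d$. $(A_0,A_1)_{\theta,q}$ denotes the usual real interpolation space (e.g. by the $K$-method), and $\hookrightarrow$ between spaces denotes continuous embedding. *)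

theory Defs
  imports "HOL-Analysis.Analysis" "HOL-Library.Function_Algebras"
begin

section \<open>Normed spaces of scalar-valued functions\<close>

text \<open>
  The scalar field is a type \<open>'k :: {real_normed_field, euclidean_space}\<close>; up to isomorphism
  these are exactly the real and the complex numbers, so both cases are covered.

  A normed space over \<open>'k\<close> is given by a carrier set of functions \<open>'i \<Rightarrow> 'k\<close>, with pointwise
  addition and scalar multiplication, and a norm that matters only on the carrier. Spaces of
  distributions have this form (\<open>'i\<close> = test functions). So has, up to isometric isomorphism,
  every normed space (let its elements act on the dual space).
\<close>

record ('i, 'k) fspace =
  vecs :: "('i \<Rightarrow> 'k) set"
  nrm  :: "('i \<Rightarrow> 'k) \<Rightarrow> real"

definition smul :: "'k::times \<Rightarrow> ('i \<Rightarrow> 'k) \<Rightarrow> ('i \<Rightarrow> 'k)" where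
  "smul c f = (\<lambda>i. c * f i)"

definition linear_subspace :: "('i \<Rightarrow> 'k::real_normed_field) set \<Rightarrow> bool" where
  "linear_subspace V \<longleftrightarrow>
     0 \<in> V \<and> (\<forall>x\<in>V. \<forall>y\<in>V. x + y \<in> V) \<and> (\<forall>c. \<forall>x\<in>V. smul c x \<in> V)"

definition normed_space :: "('i, 'k::real_normed_field) fspace \<Rightarrow> bool" where
  "normed_space A \<longleftrightarrow>
     linear_subspace (vecs A) \<and>
     (\<forall>x\<in>vecs A. 0 \<le> nrm A x \<and> (nrm A x = 0 \<longleftrightarrow> x = 0)) \<and>
     (\<forall>c. \<forall>x\<in>vecs A. nrm A (smul c x) = norm c * nrm A x) \<and>
     (\<forall>x\<in>vecs A. \<forall>y\<in>vecs A. nrm A (x + y) \<le> nrm A x + nrm A y)"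

text \<open>Set to 0 off the carrier because \<^locale>\<open>Metric_space\<close> requires a distance that is symmetric
  and nonnegative on the whole type.\<close>

definition ndist :: "('i, 'k::real_normed_field) fspace \<Rightarrow> ('i \<Rightarrow> 'k) \<Rightarrow> ('i \<Rightarrow> 'k) \<Rightarrow> real" where
  "ndist A x y = (if x \<in> vecs A \<and> y \<in> vecs A then nrm A (x - y) else 0)"

definition norm_topology :: "('i, 'k::real_normed_field) fspace \<Rightarrow> ('i \<Rightarrow> 'k) topology" where
  "norm_topology A = Metric_space.mtopology (vecs A) (ndist A)"

definition banach_space :: "('i, 'k::real_normed_field) fspace \<Rightarrow> bool" where
  "banach_space A \<longleftrightarrow> normed_space A \<and> Metric_space.mcomplete (vecs A) (ndist A)"

definition cont_embedded ::
    "('i, 'k::real_normed_field) fspace \<Rightarrow> ('i, 'k) fspace \<Rightarrow> bool" where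
  "cont_embedded A B \<longleftrightarrow>
     vecs A \<subseteq> vecs B \<and> (\<exists>C. \<forall>x\<in>vecs A. nrm B x \<le> C * nrm A x)"

definition linear_on :: "('i \<Rightarrow> 'k::real_normed_field) set \<Rightarrow> (('i \<Rightarrow> 'k) \<Rightarrow> ('j \<Rightarrow> 'k)) \<Rightarrow> bool" where
  "linear_on V F \<longleftrightarrow>
     (\<forall>x\<in>V. \<forall>y\<in>V. F (x + y) = F x + F y) \<and> (\<forall>c. \<forall>x\<in>V. F (smul c x) = smul c (F x))"

definition isomorphic_spaces ::
    "('i, 'k::real_normed_field) fspace \<Rightarrow> ('j, 'k) fspace \<Rightarrow> bool" where
  "isomorphic_spaces A B \<longleftrightarrow>
     (\<exists>F. bij_betw F (vecs A) (vecs B) \<and> linear_on (vecs A) F \<and>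
          (\<exists>c>0. \<exists>C. \<forall>x\<in>vecs A. c * nrm A x \<le> nrm B (F x) \<and> nrm B (F x) \<le> C * nrm A x))"

text \<open>Functionals are extended by 0 off the carrier, so that equal functionals are equal
  functions.\<close>

definition dual_space ::
    "('i, 'k::real_normed_field) fspace \<Rightarrow> ('i \<Rightarrow> 'k, 'k) fspace" where
  "dual_space A =
     \<lparr>vecs = {f. (\<forall>x. x \<notin> vecs A \<longrightarrow> f x = 0) \<and>
                (\<forall>x\<in>vecs A. \<forall>y\<in>vecs A. f (x + y) = f x + f y) \<and>
                (\<forall>c. \<forall>x\<in>vecs A. f (smul c x) = c * f x) \<and>
                (\<exists>C. \<forall>x\<in>vecs A. norm (f x) \<le> C * nrm A x)},
      nrm = (\<lambda>f. SUP x\<in>{x \<in> vecs A. nrm A x \<le> 1}. norm (f x))\<rparr>"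

text \<open>Duality is up to isomorphism: the norm of an intersection is only canonical up to
  equivalence.\<close>

definition separable_predual ::
    "('y, 'k::real_normed_field) fspace \<Rightarrow> ('i, 'k) fspace \<Rightarrow> bool" where
  "separable_predual Y A \<longleftrightarrow>
     banach_space Y \<and> separable_space (norm_topology Y) \<and> isomorphic_spaces (dual_space Y) A"


section \<open>Real interpolation\<close>

definition hausdorff_tvs :: "('i \<Rightarrow> 'k::real_normed_field) topology \<Rightarrow> bool" where
  "hausdorff_tvs Z \<longleftrightarrow>
     linear_subspace (topspace Z) \<and> Hausdorff_space Z \<and>
     continuous_map (prod_topology Z Z) Z (\<lambda>(x, y). x + y) \<and>
     continuous_map (prod_topology euclidean Z) Z (\<lambda>(c, x). smul c x)"

definition interpolation_couple ::
    "('i, 'k::real_normed_field) fspace \<Rightarrow> ('i, 'k) fspace \<Rightarrow> bool" where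
  "interpolation_couple A B \<longleftrightarrow>
     banach_space A \<and> banach_space B \<and>
     (\<exists>Z. hausdorff_tvs Z \<and>
          continuous_map (norm_topology A) Z (\<lambda>x. x) \<and>
          continuous_map (norm_topology B) Z (\<lambda>x. x))"

definition inter_space ::
    "('i, 'k::real_normed_field) fspace \<Rightarrow> ('i, 'k) fspace \<Rightarrow> ('i, 'k) fspace" where
  "inter_space A B = \<lparr>vecs = vecs A \<inter> vecs B, nrm = (\<lambda>x. max (nrm A x) (nrm B x))\<rparr>"

definition K_functional ::
    "('i, 'k::real_normed_field) fspace \<Rightarrow> ('i, 'k) fspace \<Rightarrow> real \<Rightarrow> ('i \<Rightarrow> 'k) \<Rightarrow> real" where
  "K_functional A B t x =
     Inf {nrm A a + t * nrm B b | a b. a \<in> vecs A \<and> b \<in> vecs B \<and> x = a + b}"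

definition K_integral ::
    "('i, 'k::real_normed_field) fspace \<Rightarrow> ('i, 'k) fspace \<Rightarrow> real \<Rightarrow> real \<Rightarrow> ('i \<Rightarrow> 'k) \<Rightarrow> ennreal"
  where
  "K_integral A B \<theta> q x =
     (\<integral>\<^sup>+ t\<in>{0<..}. ennreal ((t powr (- \<theta>) * K_functional A B t x) powr q / t) \<partial>lborel)"

definition interp_space ::
    "('i, 'k::real_normed_field) fspace \<Rightarrow> ('i, 'k) fspace \<Rightarrow> real \<Rightarrow> real \<Rightarrow> ('i, 'k) fspace" where
  "interp_space A B \<theta> q =
     \<lparr>vecs = {x. (\<exists>a\<in>vecs A. \<exists>b\<in>vecs B. x = a + b) \<and> K_integral A B \<theta> q x < \<infinity>},
      nrm = (\<lambda>x. enn2real (K_integral A B \<theta> q x) powr (1 / q))\<rparr>"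


section \<open>Distributions on the torus\<close>

text \<open>The torus is \<open>\<real>\<^sup>d / \<int>\<^sup>d\<close> with \<open>d = CARD('d)\<close>; functions on it are functions on
  \<open>real ^ 'd\<close> with period 1 in each coordinate.\<close>

definition periodic :: "(real ^ 'd \<Rightarrow> 'b) \<Rightarrow> bool" where
  "periodic f \<longleftrightarrow> (\<forall>i x. f (x + axis i 1) = f x)"

definition partial_deriv :: "'d::finite \<Rightarrow> (real ^ 'd \<Rightarrow> real) \<Rightarrow> real ^ 'd \<Rightarrow> real" where
  "partial_deriv i f x = frechet_derivative f (at x) (axis i 1)"

definition iter_deriv :: "'d::finite list \<Rightarrow> (real ^ 'd \<Rightarrow> real) \<Rightarrow> real ^ 'd \<Rightarrow> real" where
  "iter_deriv is f = foldr partial_deriv is f"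

definition test_functions :: "(real ^ 'd::finite \<Rightarrow> real) set" where
  "test_functions = {\<phi>. periodic \<phi> \<and> (\<forall>is x. iter_deriv is \<phi> differentiable (at x))}"

text \<open>A \<open>'k\<close>-valued distribution is determined by its values on real test functions, on which it
  is an arbitrary continuous real-linear map into \<open>'k\<close>. Distributions are extended by 0 to
  functions that are not test functions.\<close>

type_synonym ('d, 'k) tdist = "(real ^ 'd \<Rightarrow> real) \<Rightarrow> 'k"
type_synonym ('d, 'k) tspace = "(real ^ 'd \<Rightarrow> real, 'k) fspace"

definition distributions :: "('d::finite, 'k::real_normed_field) tdist set" where
  "distributions =
     {T. (\<forall>\<phi>. \<phi> \<notin> test_functions \<longrightarrow> T \<phi> = 0) \<and>
         (\<forall>\<phi>\<in>test_functions. \<forall>\<psi>\<in>test_functions. T (\<lambda>x. \<phi> x + \<psi> x) = T \<phi> + T \<psi>) \<and>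
         (\<forall>c. \<forall>\<phi>\<in>test_functions. T (\<lambda>x. c * \<phi> x) = of_real c * T \<phi>) \<and>
         (\<exists>N C. \<forall>\<phi>\<in>test_functions. \<forall>M.
            (\<forall>is x. length is \<le> N \<longrightarrow> \<bar>iter_deriv is \<phi> x\<bar> \<le> M) \<longrightarrow> norm (T \<phi>) \<le> C * M)}"

definition dist_partial :: "'d::finite \<Rightarrow> ('d, 'k::real_normed_field) tdist \<Rightarrow> ('d, 'k) tdist" where
  "dist_partial i T = (\<lambda>\<phi>. if \<phi> \<in> test_functions then - T (partial_deriv i \<phi>) else 0)"

definition dist_div :: "('d::finite \<Rightarrow> ('d, 'k::real_normed_field) tdist) \<Rightarrow> ('d, 'k) tdist" where
  "dist_div v = (\<Sum>j\<in>UNIV. dist_partial j (v j))"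

definition dist_of_fun ::
    "(real ^ 'd::finite \<Rightarrow> 'k::{real_normed_field, euclidean_space}) \<Rightarrow> ('d, 'k) tdist" where
  "dist_of_fun f =
     (\<lambda>\<phi>. if \<phi> \<in> test_functions then LINT x:cbox 0 1|lborel. \<phi> x *\<^sub>R f x else 0)"

definition Linfty :: "('d::finite, 'k::{real_normed_field, euclidean_space}) tspace" where
  "Linfty =
     \<lparr>vecs = {dist_of_fun f | f. periodic f \<and> f \<in> borel_measurable borel \<and>
                                (\<exists>C. AE x in lborel. norm (f x) \<le> C)},
      nrm = (\<lambda>T. Inf {C. \<exists>f. periodic f \<and> f \<in> borel_measurable borel \<and> T = dist_of_fun f \<and>
                            (AE x in lborel. norm (f x) \<le> C)})\<rparr>"

text \<open>The usual norm on \<open>H\<^sup>s\<close> is the square root of \<open>\<Sum>k\<in>\<int>\<^sup>d. (1 + \<bar>k\<bar>\<^sup>2)\<^sup>s \<bar>c\<^sub>k\<bar>\<^sup>2\<close> with Fourier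
  coefficients \<open>c\<^sub>k = T(cos(2\<pi>k\<cdot>x)) - \<i> T(sin(2\<pi>k\<cdot>x))\<close>. Since
  \<open>\<bar>c\<^sub>k\<bar>\<^sup>2 + \<bar>c\<^sub>-\<^sub>k\<bar>\<^sup>2 = 2 (\<bar>T(cos(2\<pi>k\<cdot>x))\<bar>\<^sup>2 + \<bar>T(sin(2\<pi>k\<cdot>x))\<bar>\<^sup>2)\<close> for real and for complex \<open>T\<close>,
  the sum equals the one below, which makes sense over \<open>'k\<close>.\<close>

definition sobolev_term ::
    "real \<Rightarrow> ('d::finite, 'k::real_normed_field) tdist \<Rightarrow> real ^ 'd \<Rightarrow> real" where
  "sobolev_term s T k =
     (1 + (norm k)\<^sup>2) powr s *
     ((norm (T (\<lambda>x. cos (2 * pi * (k \<bullet> x)))))\<^sup>2 + (norm (T (\<lambda>x. sin (2 * pi * (k \<bullet> x)))))\<^sup>2)"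

definition sobolev :: "real \<Rightarrow> ('d::finite, 'k::real_normed_field) tspace" where
  "sobolev s =
     \<lparr>vecs = {T \<in> distributions. sobolev_term s T summable_on {k. \<forall>i. k $ i \<in> \<int>}},
      nrm = (\<lambda>T. sqrt (\<Sum>\<^sub>\<infinity>k\<in>{k. \<forall>i. k $ i \<in> \<int>}. sobolev_term s T k))\<rparr>"


section \<open>Bourgain--Brezis spaces\<close>

text \<open>A Banach function space on the torus is a Banach space of distributions that is continuously
  embedded into the space of distributions with its weak-star topology.\<close>

definition banach_function_space :: "('d::finite, 'k::real_normed_field) tspace \<Rightarrow> bool" where
  "banach_function_space X \<longleftrightarrow>
     banach_space X \<and> vecs X \<subseteq> distributions \<and>
     (\<forall>\<phi>\<in>test_functions. \<exists>C. \<forall>T\<in>vecs X. norm (T \<phi>) \<le> C * nrm X T)"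

definition BB_space ::
    "('d::finite, 'k::{real_normed_field, euclidean_space}) tspace \<Rightarrow> bool" where
  "BB_space X \<longleftrightarrow>
     banach_function_space X \<and>
     (\<forall>v :: 'd \<Rightarrow> ('d, 'k) tdist. (\<forall>j. v j \<in> vecs X) \<longrightarrow>
        (\<exists>u :: 'd \<Rightarrow> ('d, 'k) tdist.
           (\<forall>j. u j \<in> vecs (inter_space Linfty X)) \<and> dist_div u = dist_div v))"

end

theory Submission
  imports Defs
begin

text \<open>
  Write \<open>v\<^sub>j = a\<^sub>j + b\<^sub>j\<close> with \<open>a\<^sub>j \<in> L\<^sup>\<infinity>\<close> and \<open>b\<^sub>j \<in> X\<close> in any way. Then
  \<open>K(t, a\<^sub>j) \<le> min \<parallel>a\<^sub>j\<parallel> (K(t, v\<^sub>j) + t \<parallel>b\<^sub>j\<parallel>)\<close>, so \<open>a\<^sub>j\<close> inherits membership in the interpolation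
  space from \<open>v\<^sub>j\<close>. The property of \<open>X\<close> gives \<open>u \<in> L\<^sup>\<infinity> \<inter> X\<close> with the same divergence as \<open>b\<close>, and \<open>a + u\<close> is
  the required bounded field. The interpolation space is complete because a Cauchy sequence has
  a limit in the sum space \<open>L\<^sup>\<infinity> + X\<close> (normed by \<open>K(1, \<cdot>)\<close>), and Fatou's lemma transfers the
  convergence to the norm of the interpolation space.
\<close>

section \<open>Linear structure, norm convergence and completeness in normed spaces of
  functions\<close>

lemma linear_subspaceD:
  assumes "linear_subspace V"
  shows linear_subspace_0: "0 \<in> V"
    and linear_subspace_add: "x \<in> V \<Longrightarrow> y \<in> V \<Longrightarrow> x + y \<in> V"
    and linear_subspace_smul: "x \<in> V \<Longrightarrow> smul c x \<in> V"
  using assms by (auto simp: linear_subspace_def)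

lemma smul_minus_one: "smul (- 1) x = - (x :: 'i \<Rightarrow> 'k::real_normed_field)"
  by (simp add: smul_def fun_eq_iff)

lemma smul_add_right: "smul c (x + y) = smul c x + smul c (y :: 'i \<Rightarrow> 'k::real_normed_field)"
  by (simp add: smul_def fun_eq_iff algebra_simps)

lemma linear_subspace_uminus: "linear_subspace V \<Longrightarrow> x \<in> V \<Longrightarrow> - x \<in> V"
  using linear_subspace_smul[of V x "- 1"] by (simp add: smul_minus_one)

lemma linear_subspace_diff: "linear_subspace V \<Longrightarrow> x \<in> V \<Longrightarrow> y \<in> V \<Longrightarrow> x - y \<in> V"
  using linear_subspace_add[of V x "- y"] linear_subspace_uminus[of V y] by simp

lemma linear_subspace_sum:
  "linear_subspace V \<Longrightarrow> (\<And>i. i \<in> I \<Longrightarrow> f i \<in> V) \<Longrightarrow> sum f I \<in> V"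
  by (induction I rule: infinite_finite_induct)
     (auto simp: linear_subspace_0 linear_subspace_add)

locale normed_fspace =
  fixes A :: "('i, 'k::real_normed_field) fspace"
  assumes normed_space: "normed_space A"
begin

lemma subspace: "linear_subspace (vecs A)"
  using normed_space by (simp add: normed_space_def)

lemmas zero_in [simp] = linear_subspace_0[OF subspace]
  and add_in = linear_subspace_add[OF subspace]
  and diff_in = linear_subspace_diff[OF subspace]
  and uminus_in = linear_subspace_uminus[OF subspace]
  and smul_in = linear_subspace_smul[OF subspace]
  and sum_in = linear_subspace_sum[OF subspace]

lemma nrm_nonneg: "x \<in> vecs A \<Longrightarrow> 0 \<le> nrm A x"
  and nrm_eq_0_iff: "x \<in> vecs A \<Longrightarrow> nrm A x = 0 \<longleftrightarrow> x = 0"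
  and nrm_smul: "x \<in> vecs A \<Longrightarrow> nrm A (smul c x) = norm c * nrm A x"
  and nrm_triangle: "x \<in> vecs A \<Longrightarrow> y \<in> vecs A \<Longrightarrow> nrm A (x + y) \<le> nrm A x + nrm A y"
  using normed_space by (auto simp: normed_space_def)

lemma nrm_0 [simp]: "nrm A 0 = 0"
  using nrm_eq_0_iff by auto

lemma nrm_uminus: "x \<in> vecs A \<Longrightarrow> nrm A (- x) = nrm A x"
  using nrm_smul[of x "- 1"] by (simp add: smul_minus_one)

lemma nrm_sum:
  "(\<And>i. i \<in> I \<Longrightarrow> f i \<in> vecs A) \<Longrightarrow> nrm A (sum f I) \<le> (\<Sum>i\<in>I. nrm A (f i))"
proof (induction I rule: infinite_finite_induct)
  case (insert i I)
  then show ?case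
    using nrm_triangle[of "f i" "sum f I"] sum_in[of I f] by (subst (1 2) sum.insert) auto
qed auto

lemma nrm_minus_commute: "x \<in> vecs A \<Longrightarrow> y \<in> vecs A \<Longrightarrow> nrm A (x - y) = nrm A (y - x)"
  using nrm_uminus[of "x - y"] diff_in by simp

sublocale Metric_space "vecs A" "ndist A"
proof
  fix x y z
  show "0 \<le> ndist A x y"
    by (simp add: ndist_def nrm_nonneg diff_in)
  show "ndist A x y = ndist A y x"
    by (simp add: ndist_def nrm_minus_commute)
  show "ndist A x z \<le> ndist A x y + ndist A y z"
    if "x \<in> vecs A" "y \<in> vecs A" "z \<in> vecs A"
    using that nrm_triangle[of "x - y" "y - z"] by (simp add: ndist_def diff_in)
  show "ndist A x y = 0 \<longleftrightarrow> x = y" if "x \<in> vecs A" "y \<in> vecs A"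
    using that by (simp add: ndist_def nrm_eq_0_iff diff_in)
qed

lemma limitin_norm_topology_iff:
  assumes "\<And>n. f n \<in> vecs A"
  shows "limitin (norm_topology A) f l F \<longleftrightarrow> l \<in> vecs A \<and> ((\<lambda>n. nrm A (f n - l)) \<longlongrightarrow> 0) F"
  unfolding norm_topology_def limitin_metric_dist_null
  using assms by (auto simp: ndist_def)

text \<open>Completeness is restated through \<open>nrm\<close> alone, so that later arguments never
  meet \<open>ndist\<close>, which is cut off outside the carrier.\<close>

lemma banach_space_iff:
  "banach_space A \<longleftrightarrow>
     (\<forall>\<sigma>. (\<forall>n. \<sigma> n \<in> vecs A) \<and> (\<forall>\<epsilon>>0. \<exists>N. \<forall>n\<ge>N. \<forall>k\<ge>N. nrm A (\<sigma> n - \<sigma> k) < \<epsilon>) \<longrightarrow>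
        (\<exists>x\<in>vecs A. (\<lambda>n. nrm A (\<sigma> n - x)) \<longlonglongrightarrow> 0))"
proof -
  have "MCauchy \<sigma> \<longleftrightarrow>
      (\<forall>n. \<sigma> n \<in> vecs A) \<and> (\<forall>\<epsilon>>0. \<exists>N. \<forall>n\<ge>N. \<forall>k\<ge>N. nrm A (\<sigma> n - \<sigma> k) < \<epsilon>)" for \<sigma>
    unfolding MCauchy_def by (auto simp: ndist_def range_subsetD)
  moreover have "limitin mtopology \<sigma> x sequentially \<longleftrightarrow>
      x \<in> vecs A \<and> (\<lambda>n. nrm A (\<sigma> n - x)) \<longlonglongrightarrow> 0" if "\<forall>n. \<sigma> n \<in> vecs A" for \<sigma> x
    using that limitin_norm_topology_iff[of \<sigma> x sequentially] by (simp add: norm_topology_def)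
  ultimately have "(MCauchy \<sigma> \<longrightarrow> (\<exists>x. limitin mtopology \<sigma> x sequentially)) \<longleftrightarrow>
      (\<forall>n. \<sigma> n \<in> vecs A) \<and> (\<forall>\<epsilon>>0. \<exists>N. \<forall>n\<ge>N. \<forall>k\<ge>N. nrm A (\<sigma> n - \<sigma> k) < \<epsilon>) \<longrightarrow>
        (\<exists>x\<in>vecs A. (\<lambda>n. nrm A (\<sigma> n - x)) \<longlonglongrightarrow> 0)" for \<sigma>
    by blast
  then show ?thesis
    unfolding banach_space_def mcomplete_def using normed_space by simp
qed

text \<open>The tails of \<open>g\<close> dominate the differences of partial sums, which are
  therefore Cauchy. In the sum space this produces limits of the components in \<open>A\<close> and
  in \<open>B\<close> separately.\<close>

lemma banach_space_series_converges:
  assumes "banach_space A" and f: "\<And>n. f n \<in> vecs A"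
    and g: "\<And>n. nrm A (f n) \<le> g n" "summable g"
  obtains x where "x \<in> vecs A" "(\<lambda>n. nrm A ((\<Sum>i<n. f i) - x)) \<longlonglongrightarrow> 0"
proof -
  have tail: "(\<Sum>i<n. f i) - (\<Sum>i<k. f i) = (\<Sum>i=k..<n. f i)" if "k \<le> n" for n k
    using that by (simp add: lessThan_atLeast0 sum_diff_nat_ivl)
  have le: "nrm A ((\<Sum>i<n. f i) - (\<Sum>i<k. f i)) \<le> \<bar>sum g {k..<n}\<bar>" if "k \<le> n" for n k
  proof -
    have "nrm A (\<Sum>i=k..<n. f i) \<le> (\<Sum>i=k..<n. nrm A (f i))"
      using f by (intro nrm_sum)
    also have "\<dots> \<le> sum g {k..<n}"
      using g by (intro sum_mono)
    finally show ?thesis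
      using tail[OF that] by simp
  qed
  have S: "(\<Sum>i<n. f i) \<in> vecs A" for n
    using f by (intro sum_in)
  have "\<forall>\<epsilon>>0. \<exists>N. \<forall>n\<ge>N. \<forall>k\<ge>N. nrm A ((\<Sum>i<n. f i) - (\<Sum>i<k. f i)) < \<epsilon>"
  proof (intro allI impI)
    fix \<epsilon> :: real
    assume "\<epsilon> > 0"
    then obtain N where N: "\<And>m n. m \<ge> N \<Longrightarrow> norm (sum g {m..<n}) < \<epsilon>"
      using g(2) unfolding summable_Cauchy by blast
    have "nrm A ((\<Sum>i<n. f i) - (\<Sum>i<k. f i)) < \<epsilon>" if "n \<ge> N" "k \<ge> N" for n k
    proof (cases "k \<le> n")
      case True
      then show ?thesis using le[OF True] N[OF that(2), of n] by simp
    next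
      case False
      then show ?thesis
        using le[of n k] N[OF that(1), of k] nrm_minus_commute[OF S[of n] S[of k]] by simp
    qed
    then show "\<exists>N. \<forall>n\<ge>N. \<forall>k\<ge>N. nrm A ((\<Sum>i<n. f i) - (\<Sum>i<k. f i)) < \<epsilon>" by blast
  qed
  then show ?thesis
    using assms(1) S that unfolding banach_space_iff by metis
qed

end

section \<open>The weighted integral of the \<open>K\<close>-method\<close>

text \<open>The profile \<open>g\<close> is arbitrary because the estimates also concern functions
  of t that are not K-functionals, such as K(t, x) + K(t, y) and C * min 1 t.\<close>

definition weighted_integral :: "real \<Rightarrow> real \<Rightarrow> (real \<Rightarrow> real) \<Rightarrow> ennreal" where
  "weighted_integral \<theta> q g =
     (\<integral>\<^sup>+ t\<in>{0<..}. ennreal ((t powr (- \<theta>) * g t) powr q / t) \<partial>lborel)"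

lemma K_integral_eq: "K_integral A B \<theta> q x = weighted_integral \<theta> q (\<lambda>t. K_functional A B t x)"
  by (simp add: K_integral_def weighted_integral_def)

lemma borel_measurable_weighted_integrand:
  assumes "g \<in> borel_measurable (restrict_space borel {0<..})"
  shows "(\<lambda>t. ennreal ((t powr (- \<theta>) * g t) powr q / t) * indicator {0<..} t)
           \<in> borel_measurable lborel"
proof -
  have "(\<lambda>t. ennreal ((t powr (- \<theta>) * g t) powr q / t))
      \<in> borel_measurable (restrict_space borel {0<..})"
    by (intro measurable_compose[OF _ measurable_ennreal] borel_measurable_divide
        powr_real_measurable borel_measurable_times assms measurable_restrict_space1) auto
  then show ?thesis
    by (subst (asm) borel_measurable_restrict_space_iff_ennreal) auto
qed

lemma weighted_integral_mono:
  assumes "\<And>t. t > 0 \<Longrightarrow> 0 \<le> f t" "\<And>t. t > 0 \<Longrightarrow> f t \<le> g t" "0 \<le> q"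
  shows "weighted_integral \<theta> q f \<le> weighted_integral \<theta> q g"
  unfolding weighted_integral_def
  using assms
  by (intro nn_integral_mono)
     (auto simp: indicator_def intro!: ennreal_leI divide_right_mono powr_mono2 mult_left_mono)

lemma weighted_integral_cmult:
  assumes "\<And>t. t > 0 \<Longrightarrow> 0 \<le> f t" "0 \<le> c"
    and "f \<in> borel_measurable (restrict_space borel {0<..})"
  shows "weighted_integral \<theta> q (\<lambda>t. c * f t) = ennreal (c powr q) * weighted_integral \<theta> q f"
proof -
  have "ennreal ((t powr (- \<theta>) * (c * f t)) powr q / t) * indicator {0<..} t =
      ennreal (c powr q) * (ennreal ((t powr (- \<theta>) * f t) powr q / t) * indicator {0<..} t)" for t
    using assms by (auto simp: indicator_def powr_mult ennreal_mult[symmetric])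
  then show ?thesis
    unfolding weighted_integral_def
    using borel_measurable_weighted_integrand[OF assms(3)]
    by (simp add: nn_integral_cmult)
qed

text \<open>This is convexity of the q-th power, extended to arguments that may vanish. There the
  claim reduces to c^q <= c for c in [0, 1], applied to the weight of the other argument.\<close>

lemma powr_convex_combination_le:
  fixes x y l q :: real
  assumes q: "1 \<le> q" and l: "0 \<le> l" "l \<le> 1" and xy: "0 \<le> x" "0 \<le> y"
  shows "(l * x + (1 - l) * y) powr q \<le> l * x powr q + (1 - l) * y powr q"
proof -
  have le: "c powr q \<le> c" if "0 \<le> c" "c \<le> 1" for c :: real
    using that q by (cases "c = 0") (auto intro: powr_le_one_le)
  show ?thesis
  proof (cases "x = 0 \<or> y = 0")
    case True
    then show ?thesis
      using le[of l] le[of "1 - l"] l xy by (auto simp: powr_mult intro!: mult_right_mono)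
  next
    case False
    then show ?thesis
      using convex_onD[OF powr_convex[OF q], of "1 - l" x y] l xy by simp
  qed
qed

text \<open>Minkowski's inequality, with the two norms replaced by positive upper bounds so that the
  convexity of \<open>s \<mapsto> s\<^sup>q\<close> can be applied without dividing by zero.\<close>

lemma weighted_integral_add_le:
  assumes q: "1 \<le> q" and \<alpha>: "\<alpha> > 0" and \<beta>: "\<beta> > 0"
    and f: "\<And>t. t > 0 \<Longrightarrow> 0 \<le> f t" "f \<in> borel_measurable (restrict_space borel {0<..})"
           "weighted_integral \<theta> q f \<le> ennreal (\<alpha> powr q)"
    and g: "\<And>t. t > 0 \<Longrightarrow> 0 \<le> g t" "g \<in> borel_measurable (restrict_space borel {0<..})"
           "weighted_integral \<theta> q g \<le> ennreal (\<beta> powr q)"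
  shows "weighted_integral \<theta> q (\<lambda>t. f t + g t) \<le> ennreal ((\<alpha> + \<beta>) powr q)"
proof -
  \<comment> \<open>With this weight the sum of two values u and w is
    \<open>\<alpha> + \<beta>\<close> times a convex combination of the normalised values u /
    \<open>\<alpha>\<close> and w / \<open>\<beta>\<close>.\<close>
  define l where "l = \<alpha> / (\<alpha> + \<beta>)"
  define F where "F = (\<lambda>t. ennreal ((t powr (- \<theta>) * f t) powr q / t) * indicator {0<..} t)"
  define G where "G = (\<lambda>t. ennreal ((t powr (- \<theta>) * g t) powr q / t) * indicator {0<..} t)"
  have meas: "F \<in> borel_measurable lborel" "G \<in> borel_measurable lborel"
    unfolding F_def G_def by (intro borel_measurable_weighted_integrand f g)+
  \<comment> \<open>The denominators cancel against the assumed bounds after integration, and the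
    weights \<open>l\<close> and \<open>1 - l\<close> then add up to 1.\<close>
  define cF where "cF = (\<alpha> + \<beta>) powr q * l / \<alpha> powr q"
  define cG where "cG = (\<alpha> + \<beta>) powr q * (1 - l) / \<beta> powr q"
  have l: "0 \<le> l" "l \<le> 1" "1 - l = \<beta> / (\<alpha> + \<beta>)"
    using \<alpha> \<beta> by (auto simp: l_def field_simps)
  have nn: "0 \<le> cF" "0 \<le> cG"
    using l(1,2) by (auto simp: cF_def cG_def)
  have pointwise: "ennreal ((t powr (- \<theta>) * (f t + g t)) powr q / t) * indicator {0<..} t
      \<le> ennreal cF * F t + ennreal cG * G t" for t
  proof (cases "t > 0")
    case True
    define u where "u = t powr (- \<theta>) * f t"
    define w where "w = t powr (- \<theta>) * g t"
    have uw: "0 \<le> u" "0 \<le> w"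
      using f(1) g(1) True by (auto simp: u_def w_def)
    have "l * (u / \<alpha>) = u / (\<alpha> + \<beta>)" "(1 - l) * (w / \<beta>) = w / (\<alpha> + \<beta>)"
      using \<alpha> \<beta> unfolding l(3) by (simp_all add: l_def)
    then have eq: "u + w = (\<alpha> + \<beta>) * (l * (u / \<alpha>) + (1 - l) * (w / \<beta>))"
      using \<alpha> \<beta> by (simp flip: add_divide_distrib)
    have "(l * (u / \<alpha>) + (1 - l) * (w / \<beta>)) powr q
        \<le> l * (u / \<alpha>) powr q + (1 - l) * (w / \<beta>) powr q"
      using uw \<alpha> \<beta> by (intro powr_convex_combination_le q l(1,2)) auto
    then have "(u + w) powr q \<le> (\<alpha> + \<beta>) powr q * (l * (u / \<alpha>) powr q + (1 - l) * (w / \<beta>) powr q)"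
      unfolding eq using \<alpha> \<beta> uw l by (subst powr_mult) (auto intro!: mult_left_mono)
    also have "\<dots> = cF * u powr q + cG * w powr q"
      using \<alpha> \<beta> uw by (simp add: cF_def cG_def powr_divide algebra_simps)
    finally have "(u + w) powr q / t \<le> cF * (u powr q / t) + cG * (w powr q / t)"
      using True by (simp add: field_simps)
    then show ?thesis
      using True nn
      by (simp add: F_def G_def u_def w_def distrib_left ennreal_mult[symmetric]
          ennreal_plus[symmetric] ennreal_leI del: ennreal_plus)
  qed (simp add: F_def G_def)
  have "weighted_integral \<theta> q (\<lambda>t. f t + g t) \<le> (\<integral>\<^sup>+ t. ennreal cF * F t + ennreal cG * G t \<partial>lborel)"
    unfolding weighted_integral_def by (intro nn_integral_mono pointwise)
  also have "\<dots> = ennreal cF * weighted_integral \<theta> q f + ennreal cG * weighted_integral \<theta> q g"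
    using meas by (simp add: nn_integral_add nn_integral_cmult)
      (simp add: weighted_integral_def F_def G_def)
  also have "\<dots> \<le> ennreal cF * ennreal (\<alpha> powr q) + ennreal cG * ennreal (\<beta> powr q)"
    using f(3) g(3) by (intro add_mono mult_left_mono) auto
  also have "\<dots> = ennreal (cF * \<alpha> powr q + cG * \<beta> powr q)"
    using nn by (simp add: ennreal_mult)
  also have "cF * \<alpha> powr q + cG * \<beta> powr q = (\<alpha> + \<beta>) powr q"
    using \<alpha> \<beta> by (simp add: cF_def cG_def flip: distrib_left)
  finally show ?thesis .
qed

text \<open>The integrand is t^((1 - \<theta>) q - 1) on (0, 1], integrable at 0 because \<theta> <
  1, and t^(-\<theta> q - 1) beyond 1, integrable at infinity because \<theta> > 0. The profile
  \<open>min 1 t\<close> is the error made when an element is replaced by one of its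
  summands.\<close>

lemma weighted_integral_min_finite:
  assumes "0 < \<theta>" "\<theta> < 1" "1 \<le> q"
  shows "weighted_integral \<theta> q (\<lambda>t. min 1 t) < \<infinity>"
proof -
  define a where "a = (1 - \<theta>) * q - 1"
  define b where "b = - \<theta> * q - 1"
  have a: "a > - 1" and b: "b < - 1"
    using assms by (auto simp: a_def b_def)
  have le: "ennreal ((t powr (- \<theta>) * min 1 t) powr q / t) * indicator {0<..} t
      \<le> ennreal (t powr a) * indicator {0..1} t + ennreal (t powr b) * indicator {1..} t" for t
  proof (cases "t > 0")
    case True
    have "t powr (- \<theta>) * t = t powr (1 - \<theta>)"
      using True by (simp add: powr_diff powr_minus field_simps)
    then have "(t powr (- \<theta>) * t) powr q / t = t powr a"
      using True by (simp only: powr_powr a_def) (simp add: powr_diff)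
    moreover have "(t powr (- \<theta>)) powr q / t = t powr b"
      using True by (simp add: b_def powr_powr powr_diff powr_mult_base)
    ultimately show ?thesis
      using True by (cases "t \<le> 1") (auto simp: indicator_def min_def)
  qed simp
  have "weighted_integral \<theta> q (\<lambda>t. min 1 t)
      \<le> (\<integral>\<^sup>+ t. ennreal (t powr a) * indicator {0..1} t + ennreal (t powr b) * indicator {1..} t \<partial>lborel)"
    unfolding weighted_integral_def by (intro nn_integral_mono le)
  also have "\<dots> = (\<integral>\<^sup>+ t. ennreal (t powr a) * indicator {0..1} t \<partial>lborel)
      + (\<integral>\<^sup>+ t. ennreal (t powr b) * indicator {1..} t \<partial>lborel)"
    by (intro nn_integral_add) auto
  also have "\<dots> < \<infinity>"
    using nn_integral_has_integral_lebesgue'[OF _ has_integral_powr_from_0[OF a, of 1]]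
      nn_integral_has_integral_lebesgue'[OF _ has_integral_powr_to_inf[OF b, of 1]]
    by simp
  finally show ?thesis .
qed

lemma weighted_integral_Fatou:
  assumes q: "0 < q"
    and f: "\<And>k. f k \<in> borel_measurable (restrict_space borel {0<..})"
    and nonneg: "\<And>k t. t > 0 \<Longrightarrow> 0 \<le> f k t"
    and lim: "\<And>t. t > 0 \<Longrightarrow> (\<lambda>k. f k t) \<longlonglongrightarrow> g t"
    and bound: "eventually (\<lambda>k. weighted_integral \<theta> q (f k) \<le> C) sequentially"
  shows "weighted_integral \<theta> q g \<le> C"
proof -
  define F where "F = (\<lambda>k t. ennreal ((t powr (- \<theta>) * f k t) powr q / t) * indicator {0<..} t)"
  define G where "G = (\<lambda>t. ennreal ((t powr (- \<theta>) * g t) powr q / t) * indicator {0<..} t)"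
  have "(\<lambda>k. F k t) \<longlonglongrightarrow> G t" for t
  proof (cases "t > 0")
    case True
    \<comment> \<open>The limit \<open>g t\<close> may be 0; there the q-th power is still
      continuous from the right because q > 0, and the approximants are nonnegative.\<close>
    have "(\<lambda>k. (t powr (- \<theta>) * f k t) powr q / t) \<longlonglongrightarrow> (t powr (- \<theta>) * g t) powr q / t"
      using True q nonneg[OF True]
      by (intro tendsto_divide tendsto_powr' tendsto_mult tendsto_const lim) auto
    then show ?thesis
      using True by (simp add: F_def G_def tendsto_ennrealI)
  qed (simp add: F_def G_def)
  then have "weighted_integral \<theta> q g = (\<integral>\<^sup>+ t. liminf (\<lambda>k. F k t) \<partial>lborel)"
    unfolding weighted_integral_def G_def[symmetric]
    by (intro nn_integral_cong) (metis lim_imp_Liminf trivial_limit_sequentially)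
  also have "\<dots> \<le> liminf (\<lambda>k. \<integral>\<^sup>+ t. F k t \<partial>lborel)"
    unfolding F_def by (intro nn_integral_liminf borel_measurable_weighted_integrand f)
  \<comment> \<open>Passing to the limsup allows a bound that holds only for large k.\<close>
  also have "\<dots> \<le> limsup (\<lambda>k. \<integral>\<^sup>+ t. F k t \<partial>lborel)"
    by (intro Liminf_le_Limsup) simp
  also have "\<dots> \<le> C"
    using bound by (intro Limsup_bounded) (simp add: weighted_integral_def F_def)
  finally show ?thesis .
qed

section \<open>The \<open>K\<close>-functional\<close>

definition sum_vecs ::
    "('i, 'k::real_normed_field) fspace \<Rightarrow> ('i, 'k) fspace \<Rightarrow> ('i \<Rightarrow> 'k) set" where
  "sum_vecs A B = {x. \<exists>a\<in>vecs A. \<exists>b\<in>vecs B. x = a + b}"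

locale normed_pair = A: normed_fspace A + B: normed_fspace B
  for A B :: "('i, 'k::real_normed_field) fspace"
begin

lemma sum_vecsI: "a \<in> vecs A \<Longrightarrow> b \<in> vecs B \<Longrightarrow> a + b \<in> sum_vecs A B"
  by (auto simp: sum_vecs_def)

lemma sum_vecsI1: "a \<in> vecs A \<Longrightarrow> a \<in> sum_vecs A B"
  using sum_vecsI[of a 0] by simp

lemma sum_vecsI2: "b \<in> vecs B \<Longrightarrow> b \<in> sum_vecs A B"
  using sum_vecsI[of 0 b] by simp

lemma subspace_sum_vecs: "linear_subspace (sum_vecs A B)"
  unfolding linear_subspace_def
proof (intro conjI ballI allI)
  show "0 \<in> sum_vecs A B"
    by (simp add: sum_vecsI1)
  fix x assume "x \<in> sum_vecs A B"
  then obtain a b where x: "a \<in> vecs A" "b \<in> vecs B" "x = a + b"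
    by (auto simp: sum_vecs_def)
  show "smul c x \<in> sum_vecs A B" for c
    using x by (simp add: smul_add_right sum_vecsI A.smul_in B.smul_in)
  fix y assume "y \<in> sum_vecs A B"
  then obtain a' b' where y: "a' \<in> vecs A" "b' \<in> vecs B" "y = a' + b'"
    by (auto simp: sum_vecs_def)
  have "x + y = (a + a') + (b + b')"
    by (simp add: x(3) y(3) algebra_simps)
  then show "x + y \<in> sum_vecs A B"
    using x y by (simp only: sum_vecsI A.add_in B.add_in)
qed

lemmas sum_vecs_add = linear_subspace_add[OF subspace_sum_vecs]
  and sum_vecs_diff = linear_subspace_diff[OF subspace_sum_vecs]
  and sum_vecs_smul = linear_subspace_smul[OF subspace_sum_vecs]

lemma K_functional_le:
  assumes "a \<in> vecs A" "b \<in> vecs B" "0 \<le> t"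
  shows "K_functional A B t (a + b) \<le> nrm A a + t * nrm B b"
  unfolding K_functional_def
proof (rule cInf_lower)
  show "bdd_below {nrm A a' + t * nrm B b' | a' b'. a' \<in> vecs A \<and> b' \<in> vecs B \<and> a + b = a' + b'}"
    using assms(3) by (intro bdd_belowI[of _ 0]) (auto simp: A.nrm_nonneg B.nrm_nonneg)
qed (use assms in auto)

lemma K_functional_le_left: "a \<in> vecs A \<Longrightarrow> 0 \<le> t \<Longrightarrow> K_functional A B t a \<le> nrm A a"
  using K_functional_le[of a 0 t] by simp

lemma K_functional_le_right: "b \<in> vecs B \<Longrightarrow> 0 \<le> t \<Longrightarrow> K_functional A B t b \<le> t * nrm B b"
  using K_functional_le[of 0 b t] by simp

text \<open>Membership in the sum makes the set of decomposition costs nonempty, so that a common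
  lower bound passes to the infimum.\<close>

lemma K_functional_greatest:
  assumes "x \<in> sum_vecs A B"
    and "\<And>a b. a \<in> vecs A \<Longrightarrow> b \<in> vecs B \<Longrightarrow> x = a + b \<Longrightarrow> c \<le> nrm A a + t * nrm B b"
  shows "c \<le> K_functional A B t x"
  unfolding K_functional_def
  using assms by (intro cInf_greatest) (auto simp: sum_vecs_def)

lemma K_functional_nonneg: "x \<in> sum_vecs A B \<Longrightarrow> 0 \<le> t \<Longrightarrow> 0 \<le> K_functional A B t x"
  by (intro K_functional_greatest) (auto simp: A.nrm_nonneg B.nrm_nonneg)

lemma K_functional_less_obtain:
  assumes "x \<in> sum_vecs A B" "K_functional A B t x < c"
  obtains a b where "a \<in> vecs A" "b \<in> vecs B" "x = a + b" "nrm A a + t * nrm B b < c"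
  using K_functional_greatest[OF assms(1), of c t] assms(2) by (meson not_le)

text \<open>Decompositions of x and y add up to one of x + y; the infimum is taken over those of y
  first and then over those of x.\<close>

lemma K_functional_triangle:
  assumes x: "x \<in> sum_vecs A B" and y: "y \<in> sum_vecs A B" and t: "0 \<le> t"
  shows "K_functional A B t (x + y) \<le> K_functional A B t x + K_functional A B t y"
proof -
  have "K_functional A B t (x + y) - (nrm A a + t * nrm B b) \<le> K_functional A B t y"
    if a: "a \<in> vecs A" "b \<in> vecs B" "x = a + b" for a b
  proof (rule K_functional_greatest[OF y])
    fix a' b' assume b: "a' \<in> vecs A" "b' \<in> vecs B" "y = a' + b'"
    have "x + y = (a + a') + (b + b')"
      by (simp add: a(3) b(3) algebra_simps)
    then have "K_functional A B t (x + y) \<le> nrm A (a + a') + t * nrm B (b + b')"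
      using K_functional_le[of "a + a'" "b + b'" t] a b t by (simp only: A.add_in B.add_in)
    also have "\<dots> \<le> (nrm A a + nrm A a') + t * (nrm B b + nrm B b')"
      using a b t by (intro add_mono mult_left_mono A.nrm_triangle B.nrm_triangle)
    finally show "K_functional A B t (x + y) - (nrm A a + t * nrm B b) \<le> nrm A a' + t * nrm B b'"
      by (simp add: algebra_simps)
  qed
  then have "K_functional A B t (x + y) - K_functional A B t y \<le> K_functional A B t x"
    by (intro K_functional_greatest[OF x]) (simp add: algebra_simps)
  then show ?thesis
    by simp
qed

lemma K_functional_smul_le:
  assumes x: "x \<in> sum_vecs A B" and t: "0 \<le> t" and c: "c \<noteq> 0"
  shows "norm c * K_functional A B t x \<ge> K_functional A B t (smul c x)"
proof -
  have "K_functional A B t (smul c x) / norm c \<le> K_functional A B t x"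
  proof (rule K_functional_greatest[OF x])
    fix a b assume ab: "a \<in> vecs A" "b \<in> vecs B" "x = a + b"
    have "K_functional A B t (smul c x) \<le> nrm A (smul c a) + t * nrm B (smul c b)"
      using K_functional_le[of "smul c a" "smul c b" t] ab t
      by (simp add: smul_add_right A.smul_in B.smul_in)
    also have "\<dots> = norm c * (nrm A a + t * nrm B b)"
      using ab by (simp add: A.nrm_smul B.nrm_smul algebra_simps)
    finally show "K_functional A B t (smul c x) / norm c \<le> nrm A a + t * nrm B b"
      using c by (simp add: field_simps)
  qed
  then show ?thesis
    using c by (simp add: field_simps)
qed

lemma K_functional_0 [simp]: "0 \<le> t \<Longrightarrow> K_functional A B t 0 = 0"
  using K_functional_le[of 0 0 t] K_functional_nonneg[of 0 t] sum_vecsI1[of 0] by simp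

lemma K_functional_smul:
  assumes x: "x \<in> sum_vecs A B" and t: "0 \<le> t"
  shows "K_functional A B t (smul c x) = norm c * K_functional A B t x"
proof (cases "c = 0")
  case True
  then have "smul c x = 0"
    by (simp add: smul_def fun_eq_iff)
  then show ?thesis
    using True t by simp
next
  case False
  \<comment> \<open>The reverse inequality is the one already proved, applied to the scalar
    \<open>inverse c\<close> and the vector \<open>smul c x\<close>.\<close>
  have "smul (inverse c) (smul c x) = x"
    using False by (simp add: smul_def fun_eq_iff)
  then have "K_functional A B t x \<le> norm (inverse c) * K_functional A B t (smul c x)"
    using K_functional_smul_le[of "smul c x" t "inverse c"] sum_vecs_smul[OF x, of c] t False
    by simp
  then have "norm c * K_functional A B t x \<le> K_functional A B t (smul c x)"
    using False by (simp add: nonzero_norm_inverse) (simp add: field_simps nonzero_norm_divide)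
  then show ?thesis
    using K_functional_smul_le[OF x t False] by simp
qed

lemma K_functional_diff_commute:
  assumes "x \<in> sum_vecs A B" "y \<in> sum_vecs A B" "0 \<le> t"
  shows "K_functional A B t (x - y) = K_functional A B t (y - x)"
  using K_functional_smul[of "x - y" t "- 1"] assms by (simp add: smul_minus_one sum_vecs_diff)

lemma K_functional_mono:
  assumes "x \<in> sum_vecs A B" "0 \<le> s" "s \<le> t"
  shows "K_functional A B s x \<le> K_functional A B t x"
proof (rule K_functional_greatest[OF assms(1)])
  fix a b assume ab: "a \<in> vecs A" "b \<in> vecs B" "x = a + b"
  have "K_functional A B s x \<le> nrm A a + s * nrm B b"
    using K_functional_le[OF ab(1,2) assms(2)] ab(3) by simp
  also have "\<dots> \<le> nrm A a + t * nrm B b"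
    using assms ab by (simp add: mult_right_mono B.nrm_nonneg)
  finally show "K_functional A B s x \<le> nrm A a + t * nrm B b" .
qed

text \<open>Both costs in a decomposition grow by at most the factor \<open>max 1 t\<close> relative
  to t = 1. Hence convergence in the norm K(1, _) of the sum space controls K(t, _) for each fixed
  t.\<close>

lemma K_functional_le_max:
  assumes "x \<in> sum_vecs A B" "0 \<le> t"
  shows "K_functional A B t x \<le> max 1 t * K_functional A B 1 x"
proof -
  have "K_functional A B t x / max 1 t \<le> K_functional A B 1 x"
  proof (rule K_functional_greatest[OF assms(1)])
    fix a b assume ab: "a \<in> vecs A" "b \<in> vecs B" "x = a + b"
    have "K_functional A B t x \<le> nrm A a + t * nrm B b"
      using K_functional_le[OF ab(1,2) assms(2)] ab(3) by simp
    also have "\<dots> \<le> max 1 t * nrm A a + max 1 t * nrm B b"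
      using mult_right_mono[of 1 "max 1 t" "nrm A a"] A.nrm_nonneg[OF ab(1)] B.nrm_nonneg[OF ab(2)]
      by (intro add_mono mult_right_mono) auto
    finally show "K_functional A B t x / max 1 t \<le> nrm A a + 1 * nrm B b"
      by (simp add: pos_divide_le_eq algebra_simps)
  qed
  then show ?thesis
    by (simp add: pos_divide_le_eq mult.commute)
qed

text \<open>Monotonicity in t suffices for measurability.\<close>

lemma borel_measurable_K_functional:
  assumes "x \<in> sum_vecs A B"
  shows "(\<lambda>t. K_functional A B t x) \<in> borel_measurable (restrict_space borel {0<..})"
  using K_functional_mono[OF assms] by (intro borel_measurable_mono_on_fnc mono_onI) auto

text \<open>The triangle inequality in both directions bounds the difference by K(t, x - \<sigma>
  k), which K(1, _) dominates. This supplies the pointwise convergence for Fatou's lemma.\<close>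

lemma K_functional_tendsto:
  assumes x: "x \<in> sum_vecs A B" and \<sigma>: "\<And>k. \<sigma> k \<in> sum_vecs A B" and y: "y \<in> sum_vecs A B"
    and lim: "(\<lambda>k. K_functional A B 1 (x - \<sigma> k)) \<longlonglongrightarrow> 0" and t: "t > 0"
  shows "(\<lambda>k. K_functional A B t (\<sigma> k - y)) \<longlonglongrightarrow> K_functional A B t (x - y)"
proof -
  let ?K = "K_functional A B t"
  have "norm (?K (\<sigma> k - y) - ?K (x - y)) \<le> max 1 t * K_functional A B 1 (x - \<sigma> k)" for k
  proof -
    have "?K (\<sigma> k - y) \<le> ?K (\<sigma> k - x) + ?K (x - y)"
      using K_functional_triangle[of "\<sigma> k - x" "x - y" t] x \<sigma> y t by (simp add: sum_vecs_diff)
    moreover have "?K (x - y) \<le> ?K (x - \<sigma> k) + ?K (\<sigma> k - y)"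
      using K_functional_triangle[of "x - \<sigma> k" "\<sigma> k - y" t] x \<sigma> y t by (simp add: sum_vecs_diff)
    moreover have "?K (\<sigma> k - x) = ?K (x - \<sigma> k)"
      using x \<sigma> t by (intro K_functional_diff_commute) auto
    moreover have "?K (x - \<sigma> k) \<le> max 1 t * K_functional A B 1 (x - \<sigma> k)"
      using x \<sigma> t by (intro K_functional_le_max sum_vecs_diff) auto
    ultimately show ?thesis
      unfolding real_norm_def by linarith
  qed
  then have "\<forall>k. norm (?K (\<sigma> k - y) - ?K (x - y)) \<le> max 1 t * K_functional A B 1 (x - \<sigma> k)" ..
  moreover have "(\<lambda>k. max 1 t * K_functional A B 1 (x - \<sigma> k)) \<longlonglongrightarrow> 0"
    using tendsto_mult_left[OF lim, of "max 1 t"] by simp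
  ultimately have "(\<lambda>k. ?K (\<sigma> k - y) - ?K (x - y)) \<longlonglongrightarrow> 0"
    by (rule Lim_null_comparison[OF always_eventually])
  then show ?thesis
    by (rule LIM_zero_cancel)
qed

end

section \<open>Separation and completeness of the sum space of an interpolation couple\<close>

locale couple = normed_pair +
  assumes interpolation_couple: "interpolation_couple A B"
begin

lemma banach_A: "banach_space A" and banach_B: "banach_space B"
  using interpolation_couple by (auto simp: interpolation_couple_def)

text \<open>Decompositions x = a n + b n with costs tending to 0 have a n -> 0 in \<open>A\<close>
  and b n -> 0 in \<open>B\<close>, hence both in the common space \<open>Z\<close>. Addition is
  continuous there, so the constant sequence x tends to 0, and limits in \<open>Z\<close> are
  unique.\<close>

lemma K_functional_eq_0_imp:
  assumes x: "x \<in> sum_vecs A B" and K0: "K_functional A B 1 x = 0"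
  shows "x = 0"
proof -
  obtain Z where Z: "hausdorff_tvs Z"
    and ZA: "continuous_map (norm_topology A) Z (\<lambda>x. x)"
    and ZB: "continuous_map (norm_topology B) Z (\<lambda>x. x)"
    using interpolation_couple by (auto simp: interpolation_couple_def)
  have "\<exists>a b. a \<in> vecs A \<and> b \<in> vecs B \<and> x = a + b \<and> nrm A a + 1 * nrm B b < inverse (real (Suc n))" for n
    using K_functional_less_obtain[OF x, of 1 "inverse (real (Suc n))"] K0
    by (metis inverse_positive_iff_positive of_nat_0_less_iff zero_less_Suc)
  then obtain a b where ab: "\<And>n. a n \<in> vecs A" "\<And>n. b n \<in> vecs B" "\<And>n. x = a n + b n"
      "\<And>n. nrm A (a n) + 1 * nrm B (b n) < inverse (real (Suc n))"
    by metis
  have small: "nrm A (a n) \<le> inverse (real (Suc n))" "nrm B (b n) \<le> inverse (real (Suc n))" for n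
    using ab(4)[of n] A.nrm_nonneg[OF ab(1)[of n]] B.nrm_nonneg[OF ab(2)[of n]] by linarith+
  have "(\<lambda>n. nrm A (a n)) \<longlonglongrightarrow> 0"
    using small(1) A.nrm_nonneg[OF ab(1)]
    by (intro tendsto_sandwich[OF _ _ tendsto_const LIMSEQ_inverse_real_of_nat] always_eventually allI)
  then have "limitin (norm_topology A) a 0 sequentially"
    using A.limitin_norm_topology_iff[of a 0] ab(1) by simp
  then have limA: "limitin Z a 0 sequentially"
    using continuous_map_limit[OF ZA, of a 0] by (simp add: o_def)
  have "(\<lambda>n. nrm B (b n)) \<longlonglongrightarrow> 0"
    using small(2) B.nrm_nonneg[OF ab(2)]
    by (intro tendsto_sandwich[OF _ _ tendsto_const LIMSEQ_inverse_real_of_nat] always_eventually allI)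
  then have "limitin (norm_topology B) b 0 sequentially"
    using B.limitin_norm_topology_iff[of b 0] ab(2) by simp
  then have limB: "limitin Z b 0 sequentially"
    using continuous_map_limit[OF ZB, of b 0] by (simp add: o_def)
  have "limitin (prod_topology Z Z) (\<lambda>n. (a n, b n)) (0, 0) sequentially"
    using limA limB by (simp add: limitin_pairwise o_def)
  moreover have "continuous_map (prod_topology Z Z) Z (\<lambda>(x, y). x + y)"
    using Z by (simp add: hausdorff_tvs_def)
  ultimately have "limitin Z (\<lambda>n. a n + b n) 0 sequentially"
    using continuous_map_limit[of "prod_topology Z Z" Z "\<lambda>(x, y). x + y" "\<lambda>n. (a n, b n)" "(0, 0)"]
    by (simp add: o_def)
  then have lim: "limitin Z (\<lambda>n. x) 0 sequentially"
    using ab(3) by simp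
  have "a 0 \<in> topspace Z" "b 0 \<in> topspace Z"
    using continuous_map_image_subset_topspace[OF ZA] continuous_map_image_subset_topspace[OF ZB]
      ab(1)[of 0] ab(2)[of 0]
    by (auto simp: norm_topology_def)
  then have "x \<in> topspace Z"
    using Z linear_subspace_add ab(3)[of 0] unfolding hausdorff_tvs_def by metis
  then have "limitin Z (\<lambda>n. x) x sequentially"
    by simp
  then show ?thesis
    using limitin_Hausdorff_unique[OF _ lim] Z by (simp add: hausdorff_tvs_def)
qed

text \<open>Along a rapidly Cauchy subsequence the successive differences have decompositions with
  geometrically small costs. Completeness of \<open>A\<close> and of \<open>B\<close> sums the two
  families of components.\<close>

lemma sum_space_Cauchy_subsequence_converges:
  assumes \<sigma>: "\<And>n. \<sigma> n \<in> sum_vecs A B"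
    and Cauchy: "\<And>\<epsilon>. \<epsilon> > 0 \<Longrightarrow> \<exists>N. \<forall>n\<ge>N. \<forall>k\<ge>N. K_functional A B 1 (\<sigma> n - \<sigma> k) < \<epsilon>"
  obtains x and r :: "nat \<Rightarrow> nat" where "x \<in> sum_vecs A B" "filterlim r at_top sequentially"
    "(\<lambda>k. K_functional A B 1 (x - \<sigma> (r k))) \<longlonglongrightarrow> 0"
proof -
  have "\<exists>N. \<forall>n\<ge>N. \<forall>m\<ge>N. K_functional A B 1 (\<sigma> n - \<sigma> m) < (1 / 2) ^ k" for k :: nat
    by (rule Cauchy) simp
  then obtain N where
    N: "\<And>k n m. n \<ge> N k \<Longrightarrow> m \<ge> N k \<Longrightarrow> K_functional A B 1 (\<sigma> n - \<sigma> m) < (1 / 2) ^ k"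
    by metis
  \<comment> \<open>The sum makes both \<open>r k\<close> and \<open>r (Suc k)\<close> at least
    \<open>N k\<close>; the summand \<open>k\<close> forces \<open>r\<close> to infinity.\<close>
  define r where "r k = k + (\<Sum>i\<le>k. N i)" for k
  have r: "r k \<ge> N k" "r (Suc k) \<ge> N k" "r k \<ge> k" for k
    using member_le_sum[of k "{..k}" N] by (auto simp: r_def)
  have "\<exists>a b. a \<in> vecs A \<and> b \<in> vecs B \<and> \<sigma> (r (Suc k)) - \<sigma> (r k) = a + b \<and>
      nrm A a + 1 * nrm B b < (1 / 2) ^ k" for k
    using K_functional_less_obtain[OF sum_vecs_diff[OF \<sigma> \<sigma>] N[OF r(2) r(1)]] by metis
  then obtain a b where ab: "\<And>k. a k \<in> vecs A" "\<And>k. b k \<in> vecs B"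
      "\<And>k. \<sigma> (r (Suc k)) - \<sigma> (r k) = a k + b k"
      "\<And>k. nrm A (a k) + 1 * nrm B (b k) < (1 / 2) ^ k"
    by metis
  have small: "nrm A (a k) \<le> (1 / 2) ^ k" "nrm B (b k) \<le> (1 / 2) ^ k" for k
    using ab(4)[of k] A.nrm_nonneg[OF ab(1)[of k]] B.nrm_nonneg[OF ab(2)[of k]] by linarith+
  have summable: "summable (\<lambda>k. (1 / 2 :: real) ^ k)"
    by (rule summable_geometric) simp
  obtain a' where a': "a' \<in> vecs A" "(\<lambda>n. nrm A ((\<Sum>i<n. a i) - a')) \<longlonglongrightarrow> 0"
    using A.banach_space_series_converges[OF banach_A ab(1) small(1) summable] .
  obtain b' where b': "b' \<in> vecs B" "(\<lambda>n. nrm B ((\<Sum>i<n. b i) - b')) \<longlonglongrightarrow> 0"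
    using B.banach_space_series_converges[OF banach_B ab(2) small(2) summable] .
  define x where "x = \<sigma> (r 0) + (a' + b')"
  have x: "x \<in> sum_vecs A B"
    unfolding x_def by (intro sum_vecs_add sum_vecsI \<sigma> a' b')
  \<comment> \<open>The differences telescope, so the distance of the subsequence to
    \<open>x\<close> is bounded by the errors of the two series.\<close>
  have \<sigma>_eq: "\<sigma> (r k) = \<sigma> (r 0) + ((\<Sum>i<k. a i) + (\<Sum>i<k. b i))" for k
  proof (induction k)
    case (Suc k)
    have "\<sigma> (r (Suc k)) = \<sigma> (r k) + (a k + b k)"
      using ab(3)[of k] by (metis add.commute diff_add_cancel)
    then show ?case
      unfolding Suc sum.lessThan_Suc by (simp only: ac_simps)
  qed simp
  have "K_functional A B 1 (x - \<sigma> (r k)) \<le> nrm A ((\<Sum>i<k. a i) - a') + nrm B ((\<Sum>i<k. b i) - b')" for k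
  proof -
    have S: "(\<Sum>i<k. a i) - a' \<in> vecs A" "(\<Sum>i<k. b i) - b' \<in> vecs B"
      using ab a' b' by (auto intro!: A.diff_in B.diff_in A.sum_in B.sum_in)
    have eq: "\<sigma> (r k) - x = ((\<Sum>i<k. a i) - a') + ((\<Sum>i<k. b i) - b')"
      unfolding \<sigma>_eq[of k] x_def by (simp add: algebra_simps)
    have "K_functional A B 1 (x - \<sigma> (r k)) = K_functional A B 1 (\<sigma> (r k) - x)"
      using x \<sigma> by (intro K_functional_diff_commute) auto
    then show ?thesis
      unfolding eq using K_functional_le[OF S, of 1] by simp
  qed
  then have "\<forall>k. norm (K_functional A B 1 (x - \<sigma> (r k)))
      \<le> nrm A ((\<Sum>i<k. a i) - a') + nrm B ((\<Sum>i<k. b i) - b')"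
    using K_functional_nonneg[OF sum_vecs_diff[OF x \<sigma>], of 1] by simp
  moreover have "(\<lambda>k. nrm A ((\<Sum>i<k. a i) - a') + nrm B ((\<Sum>i<k. b i) - b')) \<longlonglongrightarrow> 0"
    using tendsto_add[OF a'(2) b'(2)] by simp
  ultimately have "(\<lambda>k. K_functional A B 1 (x - \<sigma> (r k))) \<longlonglongrightarrow> 0"
    by (rule Lim_null_comparison[OF always_eventually])
  moreover have "filterlim r at_top sequentially"
    using r(3) by (intro filterlim_at_top_mono[OF filterlim_ident]) auto
  ultimately show ?thesis
    using x that by blast
qed

end

section \<open>The interpolation space\<close>

locale interpolation = couple +
  fixes \<theta> q :: real
  assumes \<theta>: "0 < \<theta>" "\<theta> < 1" and q: "1 \<le> q"
begin

abbreviation V where "V \<equiv> interp_space A B \<theta> q"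

abbreviation I where "I \<equiv> K_integral A B \<theta> q"

lemma in_V_iff: "x \<in> vecs V \<longleftrightarrow> x \<in> sum_vecs A B \<and> I x < \<infinity>"
  by (simp add: interp_space_def sum_vecs_def)

lemma in_V_imp_sum_vecs: "x \<in> vecs V \<Longrightarrow> x \<in> sum_vecs A B"
  by (simp add: in_V_iff)

lemma in_VI: "x \<in> sum_vecs A B \<Longrightarrow> I x \<le> ennreal c \<Longrightarrow> x \<in> vecs V"
  by (auto simp: in_V_iff intro: le_less_trans)

lemma nrm_V_nonneg: "0 \<le> nrm V x"
  by (simp add: interp_space_def)

text \<open>Norm estimates become estimates of the extended integral, without the q-th root and
  without \<open>enn2real\<close>.\<close>

lemma nrm_V_le_iff:
  assumes "x \<in> vecs V" "0 \<le> \<alpha>"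
  shows "nrm V x \<le> \<alpha> \<longleftrightarrow> I x \<le> ennreal (\<alpha> powr q)"
proof -
  \<comment> \<open>Membership excludes the value infinity, which \<open>enn2real\<close> would send
    to 0.\<close>
  obtain r where r: "0 \<le> r" "I x = ennreal r"
    using assms(1) by (cases "I x") (auto simp: in_V_iff)
  have "r powr (1 / q) \<le> \<alpha> \<longleftrightarrow> r \<le> \<alpha> powr q"
  proof
    assume "r powr (1 / q) \<le> \<alpha>"
    then have "(r powr (1 / q)) powr q \<le> \<alpha> powr q"
      using q by (intro powr_mono2) auto
    then show "r \<le> \<alpha> powr q"
      using r q by (simp add: powr_powr)
  next
    assume "r \<le> \<alpha> powr q"
    then have "r powr (1 / q) \<le> (\<alpha> powr q) powr (1 / q)"
      using r q by (intro powr_mono2) auto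
    then show "r powr (1 / q) \<le> \<alpha>"
      using assms(2) q by (simp add: powr_powr)
  qed
  then show ?thesis
    using r by (simp add: interp_space_def)
qed

lemma K_integral_add_le:
  assumes "x \<in> sum_vecs A B" "I x \<le> ennreal (\<alpha> powr q)" "\<alpha> > 0"
    and "y \<in> sum_vecs A B" "I y \<le> ennreal (\<beta> powr q)" "\<beta> > 0"
  shows "I (x + y) \<le> ennreal ((\<alpha> + \<beta>) powr q)"
proof -
  have "I (x + y) \<le> weighted_integral \<theta> q (\<lambda>t. K_functional A B t x + K_functional A B t y)"
    unfolding K_integral_eq using assms q
    by (intro weighted_integral_mono)
       (auto intro: K_functional_nonneg K_functional_triangle sum_vecs_add)
  also have "\<dots> \<le> ennreal ((\<alpha> + \<beta>) powr q)"
    using assms q unfolding K_integral_eq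
    by (intro weighted_integral_add_le)
       (auto intro: K_functional_nonneg borel_measurable_K_functional)
  finally show ?thesis .
qed

lemma K_integral_smul:
  assumes "x \<in> sum_vecs A B"
  shows "I (smul c x) = ennreal (norm c powr q) * I x"
proof -
  have "I (smul c x) = weighted_integral \<theta> q (\<lambda>t. norm c * K_functional A B t x)"
    unfolding K_integral_eq weighted_integral_def using assms
    by (intro nn_integral_cong) (auto simp: indicator_def K_functional_smul)
  then show ?thesis
    using assms unfolding K_integral_eq
    by (subst (asm) weighted_integral_cmult)
       (auto intro: K_functional_nonneg borel_measurable_K_functional)
qed

lemma K_integral_le_if_nrm_V_le: "x \<in> vecs V \<Longrightarrow> nrm V x \<le> \<alpha> \<Longrightarrow> I x \<le> ennreal (\<alpha> powr q)"
  using nrm_V_le_iff[of x \<alpha>] nrm_V_nonneg[of x] by auto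

lemma add_in_V: "x + y \<in> vecs V"
  and nrm_V_triangle: "nrm V (x + y) \<le> nrm V x + nrm V y"
  if "x \<in> vecs V" "y \<in> vecs V"
proof -
  have S: "x + y \<in> sum_vecs A B"
    using that by (intro sum_vecs_add in_V_imp_sum_vecs)
  \<comment> \<open>The Minkowski estimate asks for strictly positive bounds, while a norm may
    vanish; the surplus \<open>e\<close> is removed in the limit.\<close>
  have le: "I (x + y) \<le> ennreal (((nrm V x + e) + (nrm V y + e)) powr q)" if "e > 0" for e
    using \<open>x \<in> vecs V\<close> \<open>y \<in> vecs V\<close> that nrm_V_nonneg[of x] nrm_V_nonneg[of y]
    by (intro K_integral_add_le in_V_imp_sum_vecs K_integral_le_if_nrm_V_le) auto
  show V: "x + y \<in> vecs V"
    using in_VI[OF S le[of 1]] by simp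
  show "nrm V (x + y) \<le> nrm V x + nrm V y"
  proof (rule field_le_epsilon)
    fix e :: real assume "e > 0"
    then show "nrm V (x + y) \<le> nrm V x + nrm V y + e"
      using le[of "e / 2"] nrm_V_nonneg[of x] nrm_V_nonneg[of y]
      by (subst nrm_V_le_iff[OF V]) (auto simp: algebra_simps)
  qed
qed

lemma smul_in_V: "x \<in> vecs V \<Longrightarrow> smul c x \<in> vecs V"
  by (auto simp: in_V_iff K_integral_smul sum_vecs_smul ennreal_mult_less_top)

lemma nrm_V_smul: "x \<in> vecs V \<Longrightarrow> nrm V (smul c x) = norm c * nrm V x"
  using q
  by (simp add: interp_space_def K_integral_smul in_V_imp_sum_vecs enn2real_mult powr_mult powr_powr)

text \<open>Monotonicity of the \<open>K\<close>-functional bounds \<open>I x\<close> below by the integral over \<open>[1, 2]\<close>.\<close>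

lemma K_functional_le_nrm_V:
  assumes x: "x \<in> vecs V"
  shows "K_functional A B 1 x \<le> 2 * 2 powr \<theta> * nrm V x"
proof -
  let ?k = "K_functional A B 1 x"
  have S: "x \<in> sum_vecs A B"
    using x by (rule in_V_imp_sum_vecs)
  have k: "0 \<le> ?k"
    by (rule K_functional_nonneg[OF S]) simp
  \<comment> \<open>A lower bound of the integrand on [1, 2]: each of the factors t^(-\<theta>),
    K(t, x) and 1/t is replaced by a lower bound there.\<close>
  define c where "c = (2 powr (- \<theta>) * ?k) powr q / 2"
  have "ennreal c * indicator {1..2} t
      \<le> ennreal ((t powr (- \<theta>) * K_functional A B t x) powr q / t) * indicator {0<..} t" for t :: real
  proof (cases "t \<in> {1..2}")
    case True
    have "2 powr (- \<theta>) * ?k \<le> t powr (- \<theta>) * K_functional A B t x"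
      using True \<theta> k K_functional_mono[OF S, of 1 t]
      by (intro mult_mono powr_mono2') auto
    then have "(2 powr (- \<theta>) * ?k) powr q / 2 \<le> (t powr (- \<theta>) * K_functional A B t x) powr q / t"
      using True q k by (intro frac_le powr_mono2) auto
    then show ?thesis
      using True by (simp add: c_def ennreal_leI)
  qed simp
  then have "(\<integral>\<^sup>+ t. ennreal c * indicator {1..2} t \<partial>(lborel :: real measure)) \<le> I x"
    unfolding K_integral_eq weighted_integral_def by (intro nn_integral_mono)
  then have "ennreal c \<le> I x"
    by (simp add: nn_integral_cmult_indicator)
  also have "\<dots> \<le> ennreal (nrm V x powr q)"
    using K_integral_le_if_nrm_V_le[OF x] by simp
  finally have "(2 powr (- \<theta>) * ?k) powr q \<le> 2 * nrm V x powr q"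
    by (simp add: c_def)
  \<comment> \<open>Since q >= 1, the factor 2 may be moved inside the q-th power, and the powers
    can then be compared by their bases.\<close>
  also have "\<dots> \<le> 2 powr q * nrm V x powr q"
    using powr_mono[of 1 q 2] q by (intro mult_right_mono) auto
  also have "\<dots> = (2 * nrm V x) powr q"
    using nrm_V_nonneg[of x] by (simp add: powr_mult)
  finally have "2 powr (- \<theta>) * ?k \<le> 2 * nrm V x"
    using powr_less_mono2[of q "2 * nrm V x" "2 powr (- \<theta>) * ?k"] q nrm_V_nonneg[of x] by force
  then show ?thesis
    by (simp add: powr_minus field_simps)
qed

lemma zero_in_V: "0 \<in> vecs V" and nrm_V_0: "nrm V 0 = 0"
proof -
  have "I 0 = weighted_integral \<theta> q (\<lambda>t. 0)"
    unfolding K_integral_eq weighted_integral_def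
    by (intro nn_integral_cong) (auto simp: indicator_def)
  then have "I 0 = 0"
    using q by (simp add: weighted_integral_def)
  then show "0 \<in> vecs V" "nrm V 0 = 0"
    by (auto simp: in_V_iff sum_vecsI1) (simp add: interp_space_def)
qed

lemma normed_space_V: "normed_space V"
proof -
  \<comment> \<open>Definiteness comes from the couple: a vanishing norm forces K(1, x) = 0.\<close>
  have "x = 0" if "x \<in> vecs V" "nrm V x = 0" for x
  proof (rule K_functional_eq_0_imp)
    show S: "x \<in> sum_vecs A B"
      using that(1) by (rule in_V_imp_sum_vecs)
    show "K_functional A B 1 x = 0"
      using K_functional_le_nrm_V[OF that(1)] K_functional_nonneg[OF S, of 1] that(2) by simp
  qed
  then show ?thesis
    unfolding normed_space_def linear_subspace_def
    by (auto simp: zero_in_V nrm_V_0 add_in_V nrm_V_triangle smul_in_V nrm_V_smul nrm_V_nonneg)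
qed

sublocale V: normed_fspace V
  by standard (rule normed_space_V)

lemma banach_space_V: "banach_space V"
  unfolding V.banach_space_iff
proof (intro allI impI, elim conjE)
  fix \<sigma> :: "nat \<Rightarrow> _" assume \<sigma>: "\<forall>n. \<sigma> n \<in> vecs V"
    and Cauchy: "\<forall>\<epsilon>>0. \<exists>N. \<forall>n\<ge>N. \<forall>k\<ge>N. nrm V (\<sigma> n - \<sigma> k) < \<epsilon>"
  have S: "\<sigma> n \<in> sum_vecs A B" for n
    using \<sigma> by (auto intro: in_V_imp_sum_vecs)
  have K_Cauchy: "\<exists>N. \<forall>n\<ge>N. \<forall>k\<ge>N. K_functional A B 1 (\<sigma> n - \<sigma> k) < \<epsilon>" if "\<epsilon> > 0" for \<epsilon>
  proof -
    have "\<epsilon> / (2 * 2 powr \<theta>) > 0"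
      using that by simp
    then obtain N where N: "\<forall>n\<ge>N. \<forall>k\<ge>N. nrm V (\<sigma> n - \<sigma> k) < \<epsilon> / (2 * 2 powr \<theta>)"
      using Cauchy by blast
    have "K_functional A B 1 (\<sigma> n - \<sigma> k) < \<epsilon>" if "n \<ge> N" "k \<ge> N" for n k
    proof -
      have "nrm V (\<sigma> n - \<sigma> k) < \<epsilon> / (2 * 2 powr \<theta>)"
        using N that by blast
      then have "2 * 2 powr \<theta> * nrm V (\<sigma> n - \<sigma> k) < \<epsilon>"
        by (simp add: field_simps)
      then show ?thesis
        using K_functional_le_nrm_V[OF V.diff_in[of "\<sigma> n" "\<sigma> k"]] \<sigma> by fastforce
    qed
    then show ?thesis by blast
  qed
  obtain x r where x: "x \<in> sum_vecs A B" and r: "filterlim r at_top sequentially"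
    and lim: "(\<lambda>k. K_functional A B 1 (x - \<sigma> (r k))) \<longlonglongrightarrow> 0"
    using sum_space_Cauchy_subsequence_converges[OF S K_Cauchy] .
  \<comment> \<open>For fixed large n the Cauchy bound holds for \<sigma> (r k) - \<sigma> n with k
    large; Fatou's lemma lets k tend to infinity.\<close>
  have close: "\<exists>N. \<forall>n\<ge>N. I (x - \<sigma> n) \<le> ennreal (\<epsilon> powr q)" if "\<epsilon> > 0" for \<epsilon>
  proof -
    from \<open>\<epsilon> > 0\<close> obtain N where N: "\<forall>n\<ge>N. \<forall>k\<ge>N. nrm V (\<sigma> n - \<sigma> k) < \<epsilon>"
      using Cauchy by blast
    have "I (x - \<sigma> n) \<le> ennreal (\<epsilon> powr q)" if "n \<ge> N" for n
      unfolding K_integral_eq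
    proof (rule weighted_integral_Fatou)
      show "(\<lambda>k. K_functional A B t (\<sigma> (r k) - \<sigma> n)) \<longlonglongrightarrow> K_functional A B t (x - \<sigma> n)" if "t > 0" for t
        using x S lim that by (intro K_functional_tendsto[where \<sigma> = "\<lambda>k. \<sigma> (r k)"])
      have "eventually (\<lambda>k. r k \<ge> N) sequentially"
        using r by (simp add: filterlim_at_top)
      then show "eventually (\<lambda>k. weighted_integral \<theta> q (\<lambda>t. K_functional A B t (\<sigma> (r k) - \<sigma> n))
          \<le> ennreal (\<epsilon> powr q)) sequentially"
      proof eventually_elim
        case (elim k)
        then have "nrm V (\<sigma> (r k) - \<sigma> n) \<le> \<epsilon>"
          using N \<open>n \<ge> N\<close> by (simp add: less_imp_le)
        then have "I (\<sigma> (r k) - \<sigma> n) \<le> ennreal (\<epsilon> powr q)"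
          using \<sigma> by (intro K_integral_le_if_nrm_V_le V.diff_in) auto
        then show ?case
          by (simp add: K_integral_eq)
      qed
    qed (use S q in \<open>auto intro!: K_functional_nonneg borel_measurable_K_functional sum_vecs_diff\<close>)
    then show ?thesis by blast
  qed
  have diff_V: "x - \<sigma> n \<in> vecs V" if "I (x - \<sigma> n) \<le> ennreal c" for n c
    using in_VI[OF sum_vecs_diff[OF x S] that] .
  obtain n where "x - \<sigma> n \<in> vecs V"
    using close[of 1] diff_V by (meson order_refl zero_less_one)
  then have xV: "x \<in> vecs V"
    using V.add_in[of "x - \<sigma> n" "\<sigma> n"] \<sigma> by simp
  have "(\<lambda>n. nrm V (\<sigma> n - x)) \<longlonglongrightarrow> 0"
  proof (rule LIMSEQ_I)
    fix e :: real assume "e > 0"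
    then obtain N where N: "\<forall>n\<ge>N. I (x - \<sigma> n) \<le> ennreal ((e / 2) powr q)"
      using close[of "e / 2"] by auto
    have "nrm V (\<sigma> n - x) < e" if "n \<ge> N" for n
    proof -
      have "nrm V (x - \<sigma> n) \<le> e / 2"
        using N that diff_V \<open>e > 0\<close> by (subst nrm_V_le_iff) auto
      then show ?thesis
        using V.nrm_minus_commute[of x "\<sigma> n"] xV \<sigma> \<open>e > 0\<close> by simp
    qed
    then show "\<exists>N. \<forall>n\<ge>N. norm (nrm V (\<sigma> n - x) - 0) < e"
      using nrm_V_nonneg by auto
  qed
  with xV show "\<exists>x\<in>vecs V. (\<lambda>n. nrm V (\<sigma> n - x)) \<longlonglongrightarrow> 0"
    by blast
qed

text \<open>This holds for every decomposition: K(t, a) exceeds K(t, a + b) by at most a multiple of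
  \<open>min 1 t\<close>, whose weighted integral is finite.\<close>

lemma left_summand_in_V:
  assumes V: "a + b \<in> vecs V" and a: "a \<in> vecs A" and b: "b \<in> vecs B"
  shows "a \<in> vecs V"
proof -
  define C where "C = nrm A a + nrm B b + 1"
  have C: "C > 0" "nrm A a \<le> C" "nrm B b \<le> C"
    using A.nrm_nonneg[OF a] B.nrm_nonneg[OF b] by (auto simp: C_def)
  have S: "a \<in> sum_vecs A B" "b \<in> sum_vecs A B" "a + b \<in> sum_vecs A B"
    using a b by (auto intro: sum_vecsI sum_vecsI1 sum_vecsI2)
  \<comment> \<open>For t >= 1 the norm of \<open>a\<close> in \<open>A\<close> suffices. For
    smaller t, write a = (a + b) + (- b) and charge \<open>- b\<close> to \<open>B\<close> at cost t
    times its norm.\<close>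
  have le: "K_functional A B t a \<le> K_functional A B t (a + b) + C * min 1 t" if t: "t > 0" for t
  proof (cases "t \<ge> 1")
    case True
    then show ?thesis
      using K_functional_le_left[OF a, of t] C K_functional_nonneg[OF S(3), of t] by simp
  next
    case False
    have "K_functional A B t a \<le> K_functional A B t (a + b) + K_functional A B t (- b)"
      using K_functional_triangle[OF S(3) sum_vecsI2[OF B.uminus_in[OF b]], of t] t by simp
    moreover have "K_functional A B t (- b) \<le> t * nrm B b"
      using K_functional_le_right[of "- b" t] b t by (simp add: B.uminus_in B.nrm_uminus)
    moreover have "t * nrm B b \<le> C * min 1 t"
      using C t False by (simp add: mult.commute)
    ultimately show ?thesis by linarith
  qed
  have meas: "(\<lambda>t :: real. min 1 t) \<in> borel_measurable (restrict_space borel {0<..})"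
    by (intro borel_measurable_mono_on_fnc mono_onI) auto
  define \<alpha> where "\<alpha> = nrm V (a + b) + 1"
  have \<alpha>: "\<alpha> > 0" "I (a + b) \<le> ennreal (\<alpha> powr q)"
    using K_integral_le_if_nrm_V_le[OF V, of \<alpha>] nrm_V_nonneg[of "a + b"]
    unfolding \<alpha>_def by linarith+
  have "weighted_integral \<theta> q (\<lambda>t. C * min 1 t) = ennreal (C powr q) * weighted_integral \<theta> q (\<lambda>t. min 1 t)"
    using C(1) meas by (intro weighted_integral_cmult) auto
  then have "weighted_integral \<theta> q (\<lambda>t. C * min 1 t) < \<infinity>"
    using weighted_integral_min_finite[OF \<theta> q] by (simp add: ennreal_mult_less_top)
  then obtain w where w: "0 \<le> w" "weighted_integral \<theta> q (\<lambda>t. C * min 1 t) = ennreal w"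
    by (cases "weighted_integral \<theta> q (\<lambda>t. C * min 1 t)") auto
  \<comment> \<open>Its q-th power is \<open>w + 1\<close>; the added 1 keeps the bound positive
    even if the integral is 0.\<close>
  define \<beta> where "\<beta> = (w + 1) powr (1 / q)"
  have \<beta>: "\<beta> > 0" "weighted_integral \<theta> q (\<lambda>t. C * min 1 t) \<le> ennreal (\<beta> powr q)"
    using w q by (auto simp: \<beta>_def powr_powr intro!: ennreal_leI)
  have "I a \<le> weighted_integral \<theta> q (\<lambda>t. K_functional A B t (a + b) + C * min 1 t)"
    unfolding K_integral_eq using S le q
    by (intro weighted_integral_mono) (auto intro: K_functional_nonneg)
  also have "\<dots> \<le> ennreal ((\<alpha> + \<beta>) powr q)"
    using \<alpha> \<beta> S C q meas
    by (intro weighted_integral_add_le)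
       (auto intro: K_functional_nonneg borel_measurable_K_functional simp: K_integral_eq)
  finally show ?thesis
    using in_VI S(1) by blast
qed

text \<open>An element x of the intersection is the left summand of x + (- x) = 0, which lies in the
  interpolation space.\<close>

lemma inter_subset_V: "vecs A \<inter> vecs B \<subseteq> vecs V"
proof
  fix x assume "x \<in> vecs A \<inter> vecs B"
  then show "x \<in> vecs V"
    using left_summand_in_V[of x "- x"] zero_in_V B.uminus_in[of x] by simp
qed

text \<open>Estimating \<open>f\<close> on the two parts of any decomposition bounds it by a
  multiple of K(1, _), hence of the interpolation norm. It is applied to evaluation at a test
  function.\<close>

lemma functional_bounded_on_V:
  assumes add: "\<And>a b. a \<in> vecs A \<Longrightarrow> b \<in> vecs B \<Longrightarrow> norm (f (a + b)) \<le> norm (f a) + norm (f b)"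
    and A: "\<And>a. a \<in> vecs A \<Longrightarrow> norm (f a) \<le> C1 * nrm A a"
    and B: "\<And>b. b \<in> vecs B \<Longrightarrow> norm (f b) \<le> C2 * nrm B b"
  shows "\<exists>C. \<forall>x\<in>vecs V. norm (f x) \<le> C * nrm V x"
proof (intro exI ballI)
  define C where "C = \<bar>C1\<bar> + \<bar>C2\<bar> + 1"
  fix x assume x: "x \<in> vecs V"
  have C: "C > 0"
    by (simp add: C_def)
  have "norm (f x) / C \<le> K_functional A B 1 x"
  proof (rule K_functional_greatest[OF in_V_imp_sum_vecs[OF x]])
    fix a b assume ab: "a \<in> vecs A" "b \<in> vecs B" "x = a + b"
    have "norm (f x) \<le> C1 * nrm A a + C2 * nrm B b"
      using add[OF ab(1,2)] A[OF ab(1)] B[OF ab(2)] ab(3) by simp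
    also have "\<dots> \<le> C * nrm A a + C * nrm B b"
      using ab by (intro add_mono mult_right_mono A.nrm_nonneg B.nrm_nonneg) (auto simp: C_def)
    finally show "norm (f x) / C \<le> nrm A a + 1 * nrm B b"
      using C by (simp add: pos_divide_le_eq algebra_simps)
  qed
  also have "\<dots> \<le> 2 * 2 powr \<theta> * nrm V x"
    by (rule K_functional_le_nrm_V[OF x])
  finally show "norm (f x) \<le> (C * (2 * 2 powr \<theta>)) * nrm V x"
    using C by (simp add: pos_divide_le_eq algebra_simps)
qed

end

section \<open>Bounded functions and distributions on the torus\<close>

lemma iter_deriv_Cons: "iter_deriv (i # is) f = partial_deriv i (iter_deriv is f)"
  by (simp add: iter_deriv_def)

text \<open>Test functions are defined by differentiability of all iterated derivatives, so closure
  under sums requires these derivatives to be computed, by induction on the list of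
  directions.\<close>

lemma iter_deriv_add:
  assumes "\<phi> \<in> test_functions" "\<psi> \<in> test_functions"
  shows "iter_deriv is (\<lambda>x. \<phi> x + \<psi> x) = (\<lambda>x. iter_deriv is \<phi> x + iter_deriv is \<psi> x)"
proof (induction "is")
  case (Cons i "is")
  have "frechet_derivative (\<lambda>x. iter_deriv is \<phi> x + iter_deriv is \<psi> x) (at x) =
      (\<lambda>h. frechet_derivative (iter_deriv is \<phi>) (at x) h + frechet_derivative (iter_deriv is \<psi>) (at x) h)" for x
    using assms
    by (intro frechet_derivative_at[symmetric] has_derivative_add)
       (auto simp: test_functions_def frechet_derivative_works[symmetric])
  then show ?case
    unfolding iter_deriv_Cons Cons by (simp add: partial_deriv_def fun_eq_iff)
qed (simp add: iter_deriv_def)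

lemma iter_deriv_cmult:
  assumes "\<phi> \<in> test_functions"
  shows "iter_deriv is (\<lambda>x. c * \<phi> x) = (\<lambda>x. c * iter_deriv is \<phi> x)"
proof (induction "is")
  case (Cons i "is")
  have "frechet_derivative (\<lambda>x. c * iter_deriv is \<phi> x) (at x) =
      (\<lambda>h. c * frechet_derivative (iter_deriv is \<phi>) (at x) h)" for x
    using assms
    by (intro frechet_derivative_at[symmetric] has_derivative_mult_right)
       (auto simp: test_functions_def frechet_derivative_works[symmetric])
  then show ?case
    unfolding iter_deriv_Cons Cons by (simp add: partial_deriv_def fun_eq_iff)
qed (simp add: iter_deriv_def)

lemma test_functions_add:
  "\<phi> \<in> test_functions \<Longrightarrow> \<psi> \<in> test_functions \<Longrightarrow> (\<lambda>x. \<phi> x + \<psi> x) \<in> test_functions"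
  using iter_deriv_add[of \<phi> \<psi>] by (auto simp: test_functions_def periodic_def)

lemma test_functions_cmult: "\<phi> \<in> test_functions \<Longrightarrow> (\<lambda>x. c * \<phi> x) \<in> test_functions"
  using iter_deriv_cmult[of \<phi> _ c] by (auto simp: test_functions_def periodic_def)

lemma continuous_on_test_function:
  assumes "\<phi> \<in> test_functions"
  shows "continuous_on S \<phi>"
proof -
  have "\<phi> differentiable (at x)" for x
    using assms unfolding test_functions_def by (auto simp: iter_deriv_def dest: spec[of _ "[]"])
  then show ?thesis
    by (simp add: continuous_at_imp_continuous_on differentiable_imp_continuous_within)
qed

lemma test_function_bounded_on_cell:
  fixes \<phi> :: "real ^ 'd::finite \<Rightarrow> real"
  assumes "\<phi> \<in> test_functions"
  obtains M where "\<And>x. x \<in> cbox 0 1 \<Longrightarrow> \<bar>\<phi> x\<bar> \<le> M"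
proof -
  have "bounded (\<phi> ` cbox 0 1)"
    by (intro compact_imp_bounded compact_continuous_image continuous_on_test_function assms) auto
  then show ?thesis
    using that by (auto simp: bounded_iff)
qed

lemma measure_unit_cell: "measure lborel (cbox 0 (1 :: real ^ 'd::finite)) = 1"
proof -
  have "0 \<bullet> b \<le> (1 :: real ^ 'd) \<bullet> b" "(1 :: real ^ 'd) \<bullet> b = 1" if "b \<in> Basis" for b
    using that by (auto simp: Basis_vec_def inner_axis)
  then show ?thesis
    by (subst measure_lborel_cbox) (auto simp: algebra_simps)
qed

text \<open>On the unit cell, which has finite measure, the product is dominated by a
  constant.\<close>

lemma set_integrable_test_function_times_bounded:
  fixes f :: "real ^ 'd::finite \<Rightarrow> 'k::{real_normed_field, euclidean_space}"
  assumes \<phi>: "\<phi> \<in> test_functions" and f: "f \<in> borel_measurable borel" "AE x in lborel. norm (f x) \<le> C"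
  shows "set_integrable lborel (cbox 0 1) (\<lambda>x. \<phi> x *\<^sub>R f x)"
proof -
  obtain M where M: "\<And>x. x \<in> cbox 0 1 \<Longrightarrow> \<bar>\<phi> x\<bar> \<le> M"
    using test_function_bounded_on_cell[OF \<phi>] by blast
  have [measurable]: "\<phi> \<in> borel_measurable borel" "f \<in> borel_measurable borel"
    using continuous_on_test_function[OF \<phi>] f(1) by (auto intro: borel_measurable_continuous_onI)
  show ?thesis
    unfolding set_integrable_def
  proof (rule Bochner_Integration.integrable_bound)
    show "integrable lborel (\<lambda>x. indicator (cbox 0 (1 :: real ^ 'd)) x * (M * C) :: real)"
      by (intro integrable_mult_left integrable_real_indicator emeasure_lborel_cbox_finite) simp
    show "AE x in lborel. norm (indicator (cbox 0 1) x *\<^sub>R \<phi> x *\<^sub>R f x)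
        \<le> norm (indicator (cbox 0 (1 :: real ^ 'd)) x * (M * C) :: real)"
      using f(2)
    proof eventually_elim
      case (elim x)
      then show ?case
        using M[of x] by (auto simp: indicator_def abs_mult intro!: mult_mono)
    qed
  qed simp
qed

lemma norm_dist_of_fun_le:
  fixes f :: "real ^ 'd::finite \<Rightarrow> 'k::{real_normed_field, euclidean_space}"
  assumes \<phi>: "\<phi> \<in> test_functions" "\<And>x. x \<in> cbox 0 1 \<Longrightarrow> \<bar>\<phi> x\<bar> \<le> M"
    and f: "f \<in> borel_measurable borel" "AE x in lborel. norm (f x) \<le> C"
  shows "norm (dist_of_fun f \<phi>) \<le> M * C"
proof -
  have "norm (dist_of_fun f \<phi>) \<le> (LINT x:cbox 0 1|lborel. norm (\<phi> x *\<^sub>R f x))"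
    using set_integral_norm_bound[OF set_integrable_test_function_times_bounded[OF \<phi>(1) f]] \<phi>(1)
    by (simp add: dist_of_fun_def)
  also have "\<dots> \<le> (LINT x:cbox 0 (1 :: real ^ 'd)|lborel. M * C)"
    unfolding set_lebesgue_integral_def
  proof (rule integral_mono_AE)
    show "integrable lborel (\<lambda>x. indicat_real (cbox 0 1) x *\<^sub>R norm (\<phi> x *\<^sub>R f x))"
      using set_integrable_norm[OF set_integrable_test_function_times_bounded[OF \<phi>(1) f]]
      by (simp add: set_integrable_def)
    show "integrable lborel (\<lambda>x. indicat_real (cbox 0 (1 :: real ^ 'd)) x *\<^sub>R (M * C))"
      by (intro integrable_scaleR_left integrable_real_indicator emeasure_lborel_cbox_finite) simp
    show "AE x in lborel. indicat_real (cbox 0 1) x *\<^sub>R norm (\<phi> x *\<^sub>R f x)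
        \<le> indicat_real (cbox 0 1) x *\<^sub>R (M * C)"
      using f(2)
    proof eventually_elim
      case (elim x)
      then show ?case
        using \<phi>(2)[of x] by (auto simp: indicator_def intro!: mult_mono)
    qed
  qed
  also have "\<dots> = M * C"
    by (simp add: set_lebesgue_integral_def measure_unit_cell)
  finally show ?thesis .
qed

lemma Linfty_subset_distributions: "vecs Linfty \<subseteq> distributions"
proof
  fix T :: "('d::finite, 'k::{real_normed_field, euclidean_space}) tdist"
  assume "T \<in> vecs Linfty"
  then obtain f C where T: "T = dist_of_fun f" and f: "f \<in> borel_measurable borel"
      "AE x in lborel. norm (f x) \<le> C"
    by (auto simp: Linfty_def)
  note int = set_integrable_test_function_times_bounded[OF _ f]
  have "T (\<lambda>x. \<phi> x + \<psi> x) = T \<phi> + T \<psi>" if "\<phi> \<in> test_functions" "\<psi> \<in> test_functions" for \<phi> \<psi>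
    using that set_integral_add(2)[OF int[of \<phi>] int[of \<psi>]]
    by (simp add: T dist_of_fun_def test_functions_add scaleR_add_left)
  moreover have "T (\<lambda>x. c * \<phi> x) = of_real c * T \<phi>" if "\<phi> \<in> test_functions" for c \<phi>
  proof -
    have "(LINT x:cbox 0 1|lborel. c *\<^sub>R (\<phi> x *\<^sub>R f x)) = c *\<^sub>R (LINT x:cbox 0 1|lborel. \<phi> x *\<^sub>R f x)"
      by (rule set_integral_scaleR_right)
    then show ?thesis
      using that by (simp add: T dist_of_fun_def test_functions_cmult scaleR_conv_of_real[of c "_ :: 'k"])
  qed
  \<comment> \<open>Bounded functions are distributions of order 0: only the empty list of
    derivatives enters.\<close>
  moreover have bound: "norm (T \<phi>) \<le> C * M"
    if "\<phi> \<in> test_functions" "\<forall>is x. length is \<le> 0 \<longrightarrow> \<bar>iter_deriv is \<phi> x\<bar> \<le> M" for \<phi> M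
    using norm_dist_of_fun_le[OF that(1) _ f, of M] that(2) by (simp add: T iter_deriv_def mult.commute)
  moreover have "T \<phi> = 0" if "\<phi> \<notin> test_functions" for \<phi>
    using that by (simp add: T dist_of_fun_def)
  moreover have "\<exists>N C. \<forall>\<phi>\<in>test_functions. \<forall>M.
      (\<forall>is x. length is \<le> N \<longrightarrow> \<bar>iter_deriv is \<phi> x\<bar> \<le> M) \<longrightarrow> norm (T \<phi>) \<le> C * M"
    using bound by blast
  ultimately show "T \<in> distributions"
    by (simp add: distributions_def)
qed

lemma Linfty_evaluation_bounded:
  fixes \<phi> :: "real ^ 'd::finite \<Rightarrow> real"
  assumes \<phi>: "\<phi> \<in> test_functions"
  shows "\<exists>C. \<forall>T \<in> vecs (Linfty :: ('d, 'k::{real_normed_field, euclidean_space}) tspace).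
    norm (T \<phi>) \<le> C * nrm Linfty T"
proof -
  obtain M where M: "\<And>x. x \<in> cbox 0 1 \<Longrightarrow> \<bar>\<phi> x\<bar> \<le> M"
    using test_function_bounded_on_cell[OF \<phi>] by blast
  \<comment> \<open>A strictly positive bound for the test function allows division, so that the
    estimate passes to the infimum defining the norm.\<close>
  define M' where "M' = \<bar>M\<bar> + 1"
  have M': "M' > 0" "\<And>x. x \<in> cbox 0 1 \<Longrightarrow> \<bar>\<phi> x\<bar> \<le> M'"
    using M by (force simp: M'_def)+
  have "norm (T \<phi>) \<le> M' * nrm Linfty T"
    if T: "T \<in> vecs (Linfty :: ('d, 'k) tspace)" for T
  proof -
    have "norm (T \<phi>) / M' \<le> nrm Linfty T"
      unfolding Linfty_def fspace.simps
    proof (rule cInf_greatest)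
      show "{C. \<exists>f. periodic f \<and> f \<in> borel_measurable borel \<and> T = dist_of_fun f \<and>
          (AE x in lborel. norm (f x) \<le> C)} \<noteq> {}"
        using T by (auto simp: Linfty_def)
      fix C assume "C \<in> {C. \<exists>f. periodic f \<and> f \<in> borel_measurable borel \<and> T = dist_of_fun f \<and>
          (AE x in lborel. norm (f x) \<le> C)}"
      then have "norm (T \<phi>) \<le> M' * C"
        using norm_dist_of_fun_le[OF \<phi> M'(2)] by auto
      then show "norm (T \<phi>) / M' \<le> C"
        using M'(1) by (simp add: pos_divide_le_eq mult.commute)
    qed
    then show ?thesis
      using M'(1) by (simp add: pos_divide_le_eq mult.commute)
  qed
  then show ?thesis by blast
qed

lemma distributions_add:
  assumes "S \<in> distributions" "T \<in> distributions"
  shows "S + T \<in> distributions"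
proof -
  obtain N C where S: "\<And>\<phi> M. \<phi> \<in> test_functions \<Longrightarrow>
      (\<And>is x. length is \<le> N \<Longrightarrow> \<bar>iter_deriv is \<phi> x\<bar> \<le> M) \<Longrightarrow> norm (S \<phi>) \<le> C * M"
    using assms(1) unfolding distributions_def by blast
  obtain N' C' where T: "\<And>\<phi> M. \<phi> \<in> test_functions \<Longrightarrow>
      (\<And>is x. length is \<le> N' \<Longrightarrow> \<bar>iter_deriv is \<phi> x\<bar> \<le> M) \<Longrightarrow> norm (T \<phi>) \<le> C' * M"
    using assms(2) unfolding distributions_def by blast
  \<comment> \<open>Derivatives up to the larger of the two orders control both
    distributions.\<close>
  have "norm ((S + T) \<phi>) \<le> (C + C') * M"
    if \<phi>: "\<phi> \<in> test_functions" and M: "\<forall>is x. length is \<le> max N N' \<longrightarrow> \<bar>iter_deriv is \<phi> x\<bar> \<le> M" for \<phi> M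
  proof -
    have "norm (S \<phi>) \<le> C * M"
      using M by (intro S[OF \<phi>]) (simp add: le_max_iff_disj)
    moreover have "norm (T \<phi>) \<le> C' * M"
      using M by (intro T[OF \<phi>]) (simp add: le_max_iff_disj)
    ultimately show ?thesis
      using norm_triangle_ineq[of "S \<phi>" "T \<phi>"] by (simp add: distrib_right)
  qed
  then have "\<exists>N C. \<forall>\<phi>\<in>test_functions. \<forall>M.
      (\<forall>is x. length is \<le> N \<longrightarrow> \<bar>iter_deriv is \<phi> x\<bar> \<le> M) \<longrightarrow> norm ((S + T) \<phi>) \<le> C * M"
    by blast
  moreover have "\<forall>\<phi>. \<phi> \<notin> test_functions \<longrightarrow> (S + T) \<phi> = 0"
      "\<forall>\<phi>\<in>test_functions. \<forall>\<psi>\<in>test_functions. (S + T) (\<lambda>x. \<phi> x + \<psi> x) = (S + T) \<phi> + (S + T) \<psi>"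
      "\<forall>c. \<forall>\<phi>\<in>test_functions. (S + T) (\<lambda>x. c * \<phi> x) = of_real c * (S + T) \<phi>"
    using assms by (simp_all add: distributions_def distrib_left)
  ultimately show ?thesis
    unfolding distributions_def by (intro CollectI conjI)
qed

lemma dist_partial_add: "dist_partial i (S + T) = dist_partial i S + dist_partial i T"
  by (simp add: dist_partial_def fun_eq_iff)

lemma dist_div_add: "dist_div (\<lambda>j. v j + w j) = dist_div v + dist_div w"
  unfolding dist_div_def dist_partial_add by (rule sum.distrib)

section \<open>The Bourgain-Brezis property of the interpolation space\<close>

theorem theorem2:
  fixes X :: "('d::finite, 'k::{real_normed_field, euclidean_space}) tspace"
    and Y :: "('y, 'k) fspace"
    and m \<theta> q :: real
  assumes "CARD('d) \<ge> 2"
    and "BB_space X"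
    and "interpolation_couple Linfty X"
    and "separable_predual Y (inter_space Linfty X)"
    and "m > real CARD('d) / 2"
    and "cont_embedded X (sobolev (- m))"
    and "0 < \<theta>" and "\<theta> < 1"
    and "1 \<le> q"
  shows "BB_space (interp_space Linfty X \<theta> q)"
proof -
  interpret interpolation "Linfty :: ('d, 'k) tspace" X \<theta> q
    using assms by unfold_locales (auto simp: interpolation_couple_def banach_space_def)
  have X: "vecs X \<subseteq> distributions"
      "\<And>\<phi>. \<phi> \<in> test_functions \<Longrightarrow> \<exists>C. \<forall>T\<in>vecs X. norm (T \<phi>) \<le> C * nrm X T"
    using assms(2) by (auto simp: BB_space_def banach_function_space_def)
  have "vecs V \<subseteq> distributions"
    using X(1) Linfty_subset_distributions
    by (auto simp: in_V_iff sum_vecs_def intro!: distributions_add)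
  moreover have "\<exists>C. \<forall>T\<in>vecs V. norm (T \<phi>) \<le> C * nrm V T" if \<phi>: "\<phi> \<in> test_functions" for \<phi>
  proof -
    obtain C1 where "\<forall>T\<in>vecs (Linfty :: ('d, 'k) tspace). norm (T \<phi>) \<le> C1 * nrm Linfty T"
      using Linfty_evaluation_bounded[OF \<phi>] by blast
    moreover obtain C2 where "\<forall>T\<in>vecs X. norm (T \<phi>) \<le> C2 * nrm X T"
      using X(2)[OF \<phi>] by blast
    ultimately show ?thesis
      by (intro functional_bounded_on_V[where f = "\<lambda>T. T \<phi>"]) (auto simp: norm_triangle_ineq)
  qed
  ultimately have "banach_function_space V"
    by (simp add: banach_function_space_def banach_space_V)
  moreover have "\<exists>u. (\<forall>j. u j \<in> vecs (inter_space Linfty V)) \<and> dist_div u = dist_div v"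
    if v: "\<forall>j. v j \<in> vecs V" for v :: "'d \<Rightarrow> ('d, 'k) tdist"
  proof -
    have "\<forall>j. \<exists>a b. a \<in> vecs Linfty \<and> b \<in> vecs X \<and> v j = a + b"
      using v in_V_imp_sum_vecs unfolding sum_vecs_def by blast
    then obtain a b where ab: "\<And>j. a j \<in> vecs Linfty" "\<And>j. b j \<in> vecs X" "\<And>j. v j = a j + b j"
      by metis
    \<comment> \<open>Only the part in \<open>X\<close> is replaced; the part \<open>a\<close> is
      already bounded and stays in the interpolation space.\<close>
    obtain u where u: "\<And>j. u j \<in> vecs (inter_space Linfty X)" "dist_div u = dist_div b"
      using assms(2) ab(2) unfolding BB_space_def by metis
    have "a j \<in> vecs V" for j
      using left_summand_in_V[of "a j" "b j"] ab v by metis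
    moreover have "u j \<in> vecs V" "u j \<in> vecs Linfty" for j
      using u(1)[of j] inter_subset_V by (auto simp: inter_space_def)
    ultimately have "a j + u j \<in> vecs (inter_space Linfty V)" for j
      using ab(1) by (simp add: inter_space_def A.add_in V.add_in)
    moreover have "v = (\<lambda>j. a j + b j)"
      using ab(3) by (rule ext)
    then have "dist_div (\<lambda>j. a j + u j) = dist_div v"
      using u(2) by (simp only: dist_div_add)
    ultimately show ?thesis
      by (intro exI[of _ "\<lambda>j. a j + u j"]) simp
  qed
  ultimately show ?thesis
    by (simp add: BB_space_def)
qed

end
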